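(* Let $s\ge 2$ be an integer and let $T$ be a finite tree. Let $m$ be the number of essential vertices of $T$ (vertices of degree $\ge 3$) and let $k\le m$ be the number of vertices of $T$ of degree exactly three. Let $n=2(m-k+l)+\varepsilon$ be a positive integer, where $\varepsilon\in\{0,1\}$ and $l$ is an integer with $l\le \lfloor k/s\rfloor (s-1)$, and assume $T$ is sufficiently subdivided for $n$. Then $$\mathrm{TC}_s(U\mathcal{D}^nT)\ \ge\ s(m-k+l).$$
   Context: A tree is a connected graph without cycles, viewed as a one-dimensional CW complex. $T$ is sufficiently subdivided for $n$ if it has at least $n$ vertices and each path between distinct vertices of degree $\neq 2$ contains at least $n-1$ edges. Subdividing edges changes neither $m$ nor $k$. $U\mathcal{D}^nT$ (Abrams' discrete model of the unordered configuration space of $n$ points in $T$): let $\mathcal{D}^nT$ be the largest cubical subcomplex of $T^n$ contained in $\{(x_1,\dots,x_n)\in T^n : x_i\ne x_j \text{ for } i\neq j\}$; $U\mathcal{D}^nT$ is its quotient by the action of the symmetric group $\Sigma_n$ permuting coordinates. Its cells are the sets $\{a_1,\dots,a_n\}$ of pairwise disjoint closed cells of $T$ (each $a_i$ a vertex or a closed edge), with dimension equal to the number of $a_i$ that are edges. $\mathrm{TC}_s(X)$ for a path-connected space $X$ and $s\ge 2$: with $PX$ the space of paths $[0,1]\to X$ and $e_s:PX\to X^s$, $e_s(\gamma)=\left(\gamma(0),\gamma(\tfrac1{s-1}),\dots,\gamma(1)\right)$, the number $\mathrm{TC}_s(X)+1$ is the minimal number of open sets covering $X^s$ on each of which $e_s$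 admits a continuous section (reduced convention, so $\mathrm{TC}_s(\text{point})=0$). *)

theory Defs
  imports "HOL-Analysis.Analysis" "HOL-Combinatorics.Permutations"
begin

section \<open>Finite trees\<close>

text \<open>
  A finite graph is given by its vertex set \<open>V\<close> and its set \<open>E\<close> of edges, an edge being
  a two-element set of vertices.  A tree has neither loops nor parallel edges, so every finite tree
  is of this form.
\<close>

definition fin_graph :: "'a set \<Rightarrow> 'a set set \<Rightarrow> bool" where
  "fin_graph V E \<longleftrightarrow> finite V \<and> (\<forall>e\<in>E. e \<subseteq> V \<and> card e = 2)"

definition graph_path :: "'a set \<Rightarrow> 'a set set \<Rightarrow> 'a list \<Rightarrow> bool" where
  "graph_path V E p \<longleftrightarrow>
     p \<noteq> [] \<and> set p \<subseteq> V \<and> distinct p \<and> successively (\<lambda>u v. {u, v} \<in> E) p"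

definition graph_connected :: "'a set \<Rightarrow> 'a set set \<Rightarrow> bool" where
  "graph_connected V E \<longleftrightarrow>
     V \<noteq> {} \<and> (\<forall>u\<in>V. \<forall>v\<in>V. \<exists>p. graph_path V E p \<and> hd p = u \<and> last p = v)"

definition graph_cycle :: "'a set \<Rightarrow> 'a set set \<Rightarrow> 'a list \<Rightarrow> bool" where
  "graph_cycle V E p \<longleftrightarrow> graph_path V E p \<and> 3 \<le> length p \<and> {last p, hd p} \<in> E"

definition fin_tree :: "'a set \<Rightarrow> 'a set set \<Rightarrow> bool" where
  "fin_tree V E \<longleftrightarrow> fin_graph V E \<and> graph_connected V E \<and> (\<nexists>p. graph_cycle V E p)"

definition vertex_degree :: "'a set set \<Rightarrow> 'a \<Rightarrow> nat" where
  "vertex_degree E v = card {e \<in> E. v \<in> e}"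

definition essential_vertices :: "'a set \<Rightarrow> 'a set set \<Rightarrow> 'a set" where
  "essential_vertices V E = {v \<in> V. 3 \<le> vertex_degree E v}"

text \<open>A path with vertex list \<open>p\<close> has \<open>length p - 1\<close> edges.\<close>

definition sufficiently_subdivided :: "'a set \<Rightarrow> 'a set set \<Rightarrow> nat \<Rightarrow> bool" where
  "sufficiently_subdivided V E n \<longleftrightarrow>
     n \<le> card V \<and>
     (\<forall>p. graph_path V E p \<and> hd p \<noteq> last p \<and> vertex_degree E (hd p) \<noteq> 2 \<and> vertex_degree E (last p) \<noteq> 2
        \<longrightarrow> n - 1 \<le> length p - 1)"


section \<open>The tree as a one-dimensional CW complex\<close>

text \<open>
  Points of the geometric realization are written in barycentric coordinates: a point is a function
  \<open>p\<close> on \<open>V\<close> whose support lies in a single vertex or a single edge.  For a finite graph the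
  CW topology is the subspace topology inherited from the product \<open>\<real>\<close>-to-the-\<open>V\<close>.
\<close>

definition closed_cell :: "'a set \<Rightarrow> 'a set \<Rightarrow> ('a \<Rightarrow> real) set" where
  "closed_cell V \<sigma> =
     {p \<in> extensional V. (\<forall>v\<in>V. 0 \<le> p v) \<and> (\<Sum>v\<in>V. p v) = 1 \<and> (\<forall>v\<in>V - \<sigma>. p v = 0)}"

definition closed_cells :: "'a set \<Rightarrow> 'a set set \<Rightarrow> ('a \<Rightarrow> real) set set" where
  "closed_cells V E = closed_cell V ` ((\<lambda>v. {v}) ` V \<union> E)"

definition realization :: "'a set \<Rightarrow> 'a set set \<Rightarrow> ('a \<Rightarrow> real) topology" where
  "realization V E = subtopology (powertop_real V) (\<Union>(closed_cells V E))"


section \<open>Discrete unordered configuration spaces\<close>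

definition power_space :: "nat \<Rightarrow> 'b topology \<Rightarrow> (nat \<Rightarrow> 'b) topology" where
  "power_space n X = product_topology (\<lambda>_. X) {..<n}"

definition configurations :: "nat \<Rightarrow> 'b topology \<Rightarrow> (nat \<Rightarrow> 'b) set" where
  "configurations n X = {x \<in> topspace (power_space n X). inj_on x {..<n}}"

definition cubes :: "'a set \<Rightarrow> 'a set set \<Rightarrow> nat \<Rightarrow> (nat \<Rightarrow> 'a \<Rightarrow> real) set set" where
  "cubes V E n = {(\<Pi>\<^sub>E i\<in>{..<n}. c i) | c. \<forall>i<n. c i \<in> closed_cells V E}"

text \<open>
  A subcomplex is a union of closed cells; faces need not be mentioned, because a closed
  cube contains its faces and these are again members of \<^term>\<open>cubes V E n\<close>.
\<close>

definition cubical_subcomplex ::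
    "'a set \<Rightarrow> 'a set set \<Rightarrow> nat \<Rightarrow> (nat \<Rightarrow> 'a \<Rightarrow> real) set \<Rightarrow> bool" where
  "cubical_subcomplex V E n A \<longleftrightarrow> (\<exists>C \<subseteq> cubes V E n. A = \<Union>C)"

definition discrete_conf_set :: "'a set \<Rightarrow> 'a set set \<Rightarrow> nat \<Rightarrow> (nat \<Rightarrow> 'a \<Rightarrow> real) set" where
  "discrete_conf_set V E n =
     \<Union>{A. cubical_subcomplex V E n A \<and> A \<subseteq> configurations n (realization V E)}"

definition discrete_conf :: "'a set \<Rightarrow> 'a set set \<Rightarrow> nat \<Rightarrow> (nat \<Rightarrow> 'a \<Rightarrow> real) topology" where
  "discrete_conf V E n =
     subtopology (power_space n (realization V E)) (discrete_conf_set V E n)"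

definition quotient_topology :: "'b topology \<Rightarrow> ('b \<Rightarrow> 'c) \<Rightarrow> 'c topology" where
  "quotient_topology X q =
     topology (\<lambda>U. U \<subseteq> q ` topspace X \<and> openin X {x \<in> topspace X. q x \<in> U})"

definition perm_orbit :: "nat \<Rightarrow> (nat \<Rightarrow> 'b) \<Rightarrow> (nat \<Rightarrow> 'b) set" where
  "perm_orbit n x = {x \<circ> \<pi> | \<pi>. \<pi> permutes {..<n}}"

definition unordered_discrete_conf ::
    "'a set \<Rightarrow> 'a set set \<Rightarrow> nat \<Rightarrow> (nat \<Rightarrow> 'a \<Rightarrow> real) set topology" where
  "unordered_discrete_conf V E n = quotient_topology (discrete_conf V E n) (perm_orbit n)"


section \<open>Higher topological complexity\<close>

text \<open>
  The path space carries the compact-open topology.  Paths are made extensional outside the unit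
  interval, so that each path is represented by exactly one function; the choice \<open>K = {}\<close> shows
  that the whole path space is open.
\<close>

definition paths :: "'b topology \<Rightarrow> (real \<Rightarrow> 'b) set" where
  "paths X = {\<gamma> \<in> extensional {0..1}. pathin X \<gamma>}"

definition path_space :: "'b topology \<Rightarrow> (real \<Rightarrow> 'b) topology" where
  "path_space X = topology_generated_by
     {{\<gamma> \<in> paths X. \<gamma> ` K \<subseteq> W} | K W. compact K \<and> K \<subseteq> {0..1} \<and> openin X W}"

definition path_eval :: "nat \<Rightarrow> (real \<Rightarrow> 'b) \<Rightarrow> nat \<Rightarrow> 'b" where
  "path_eval s \<gamma> = (\<lambda>i\<in>{..<s}. \<gamma> (real i / (real s - 1)))"

definition admits_section :: "nat \<Rightarrow> 'b topology \<Rightarrow> (nat \<Rightarrow> 'b) set \<Rightarrow> bool" where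
  "admits_section s X U \<longleftrightarrow>
     (\<exists>\<sigma>. continuous_map (subtopology (power_space s X) U) (path_space X) \<sigma> \<and>
          (\<forall>x\<in>U. path_eval s (\<sigma> x) = x))"

text \<open>
  The infimum is \<open>\<infinity>\<close> if no finite cover exists.  The truncated subtraction is harmless:
  see \<open>TC_plus_one\<close> below.
\<close>

definition TC_cover_number :: "nat \<Rightarrow> 'b topology \<Rightarrow> enat" where
  "TC_cover_number s X =
     Inf {enat (card \<U>) | \<U>. finite \<U> \<and> \<Union>\<U> = topspace (power_space s X) \<and>
            (\<forall>U\<in>\<U>. openin (power_space s X) U \<and> admits_section s X U)}"

definition TC :: "nat \<Rightarrow> 'b topology \<Rightarrow> enat" where
  "TC s X = TC_cover_number s X - 1"


section \<open>Consistency of the definitions\<close>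

lemma openin_quotient_topology:
  "openin (quotient_topology X q) U \<longleftrightarrow>
     U \<subseteq> q ` topspace X \<and> openin X {x \<in> topspace X. q x \<in> U}"
proof -
  have "istopology (\<lambda>U. U \<subseteq> q ` topspace X \<and> openin X {x \<in> topspace X. q x \<in> U})"
    unfolding istopology_def
  proof (rule conjI; intro allI impI)
    fix S T
    assume S: "S \<subseteq> q ` topspace X \<and> openin X {x \<in> topspace X. q x \<in> S}"
      and T: "T \<subseteq> q ` topspace X \<and> openin X {x \<in> topspace X. q x \<in> T}"
    have "{x \<in> topspace X. q x \<in> S \<inter> T} =
        {x \<in> topspace X. q x \<in> S} \<inter> {x \<in> topspace X. q x \<in> T}"
      by auto
    with S T show "S \<inter> T \<subseteq> q ` topspace X \<and> openin X {x \<in> topspace X. q x \<in> S \<inter> T}"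
      by (auto intro: openin_Int)
  next
    fix \<K>
    assume K: "\<forall>K\<in>\<K>. K \<subseteq> q ` topspace X \<and> openin X {x \<in> topspace X. q x \<in> K}"
    have "{x \<in> topspace X. q x \<in> \<Union>\<K>} = (\<Union>K\<in>\<K>. {x \<in> topspace X. q x \<in> K})"
      by auto
    with K show "\<Union>\<K> \<subseteq> q ` topspace X \<and> openin X {x \<in> topspace X. q x \<in> \<Union>\<K>}"
      by (auto intro!: openin_Union)
  qed
  then show ?thesis
    by (simp add: quotient_topology_def topology_inverse')
qed

lemma topspace_quotient_topology: "topspace (quotient_topology X q) = q ` topspace X"
proof
  show "topspace (quotient_topology X q) \<subseteq> q ` topspace X"
    using openin_topspace[of "quotient_topology X q"] unfolding openin_quotient_topology by blast
  have "{x \<in> topspace X. q x \<in> q ` topspace X} = topspace X"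
    by auto
  then have "openin (quotient_topology X q) (q ` topspace X)"
    by (simp add: openin_quotient_topology)
  then show "q ` topspace X \<subseteq> topspace (quotient_topology X q)"
    by (rule openin_subset)
qed

lemma quotient_map_quotient_topology: "quotient_map X (quotient_topology X q) q"
  by (auto simp: quotient_map_def topspace_quotient_topology openin_quotient_topology)

lemma TC_plus_one:
  assumes "topspace X \<noteq> {}"
  shows "TC s X + 1 = TC_cover_number s X"
proof -
  have ne: "topspace (power_space s X) \<noteq> {}"
    using assms by (simp add: power_space_def PiE_eq_empty_iff)
  have "1 \<le> TC_cover_number s X"
    unfolding TC_cover_number_def
  proof (rule Inf_greatest)
    fix k
    assume "k \<in> {enat (card \<U>) | \<U>. finite \<U> \<and> \<Union>\<U> = topspace (power_space s X) \<and>
            (\<forall>U\<in>\<U>. openin (power_space s X) U \<and> admits_section s X U)}"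
    then obtain \<U> where "k = enat (card \<U>)" "finite \<U>" "\<Union>\<U> = topspace (power_space s X)"
      by blast
    moreover from this ne have "\<U> \<noteq> {}"
      by blast
    ultimately show "1 \<le> k"
      by (simp add: one_enat_def Suc_le_eq card_gt_0_iff)
  qed
  then show ?thesis
    unfolding TC_def by (cases "TC_cover_number s X") (auto simp: one_enat_def)
qed

lemma topspace_path_space: "topspace (path_space X) = paths X"
proof -
  have "paths X \<in> {{\<gamma> \<in> paths X. \<gamma> ` K \<subseteq> W} | K W. compact K \<and> K \<subseteq> {0..1} \<and> openin X W}"
    by (rule CollectI, rule exI[of _ "{}"], rule exI[of _ "{}"]) auto
  then show ?thesis
    unfolding path_space_def by auto
qed

text \<open>
  The discrete configuration space is the union of the products of pairwise disjoint closed cells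
  of the tree.
\<close>

lemma discrete_conf_set_eq:
  "discrete_conf_set V E n =
     \<Union>{(\<Pi>\<^sub>E i\<in>{..<n}. c i) | c.
         (\<forall>i<n. c i \<in> closed_cells V E) \<and> disjoint_family_on c {..<n}}"
proof (intro equalityI subsetI)
  fix x
  assume "x \<in> discrete_conf_set V E n"
  then obtain C A where C: "C \<subseteq> cubes V E n" and xA: "A \<in> C" "x \<in> A"
    and conf: "\<Union>C \<subseteq> configurations n (realization V E)"
    unfolding discrete_conf_set_def cubical_subcomplex_def by blast
  from C xA obtain c where A: "A = (\<Pi>\<^sub>E i\<in>{..<n}. c i)"
    and c: "\<forall>i<n. c i \<in> closed_cells V E"
    unfolding cubes_def by blast
  have "disjoint_family_on c {..<n}"
    unfolding disjoint_family_on_def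
  proof (intro ballI impI)
    fix i j
    assume i: "i \<in> {..<n}" and j: "j \<in> {..<n}" and "i \<noteq> j"
    show "c i \<inter> c j = {}"
    proof (rule ccontr)
      assume "c i \<inter> c j \<noteq> {}"
      then obtain y where y: "y \<in> c i" "y \<in> c j"
        by blast
      have "x(i := y, j := y) \<in> A"
        using \<open>x \<in> A\<close> y i j unfolding A by (auto simp: PiE_iff extensional_def)
      then have "inj_on (x(i := y, j := y)) {..<n}"
        using conf xA(1) unfolding configurations_def by blast
      then show False
        using i j \<open>i \<noteq> j\<close> by (auto dest!: inj_onD[of _ _ i j])
    qed
  qed
  with xA A c show "x \<in> \<Union>{(\<Pi>\<^sub>E i\<in>{..<n}. c i) | c.
         (\<forall>i<n. c i \<in> closed_cells V E) \<and> disjoint_family_on c {..<n}}"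
    by blast
next
  fix x
  assume "x \<in> \<Union>{(\<Pi>\<^sub>E i\<in>{..<n}. c i) | c.
         (\<forall>i<n. c i \<in> closed_cells V E) \<and> disjoint_family_on c {..<n}}"
  then obtain c where x: "x \<in> (\<Pi>\<^sub>E i\<in>{..<n}. c i)"
    and c: "\<forall>i<n. c i \<in> closed_cells V E" and disj: "disjoint_family_on c {..<n}"
    by blast
  have "(\<Pi>\<^sub>E i\<in>{..<n}. c i) \<subseteq> configurations n (realization V E)"
  proof
    fix z
    assume z: "z \<in> (\<Pi>\<^sub>E i\<in>{..<n}. c i)"
    have "c i \<subseteq> topspace (realization V E)" if "i < n" for i
    proof -
      have "\<Union>(closed_cells V E) \<subseteq> extensional V"
        by (auto simp: closed_cells_def closed_cell_def)
      then have "topspace (realization V E) = \<Union>(closed_cells V E)"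
        by (auto simp: realization_def PiE_def)
      then show ?thesis
        using c that by auto
    qed
    then have "z \<in> topspace (power_space n (realization V E))"
      using z by (auto simp: power_space_def PiE_iff)
    moreover have "inj_on z {..<n}"
    proof (rule inj_onI, rule ccontr)
      fix i j
      assume i: "i \<in> {..<n}" and j: "j \<in> {..<n}" and "z i = z j" "i \<noteq> j"
      moreover have "z i \<in> c i" "z j \<in> c j"
        using z i j by (auto simp: PiE_iff)
      ultimately show False
        using disj unfolding disjoint_family_on_def by fastforce
    qed
    ultimately show "z \<in> configurations n (realization V E)"
      by (simp add: configurations_def)
  qed
  moreover have "cubical_subcomplex V E n (\<Pi>\<^sub>E i\<in>{..<n}. c i)"
    unfolding cubical_subcomplex_def cubes_def
    using c by (intro exI[of _ "{\<Pi>\<^sub>E i\<in>{..<n}. c i}"]) auto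
  ultimately show "x \<in> discrete_conf_set V E n"
    using x unfolding discrete_conf_set_def by blast
qed

end

(*
  Write r = m - k + l.  Two particles can be exchanged inside a tripod at an essential vertex, and
  doing this independently at r vertices (n = 2 r particles, or one more at rest on a leaf) gives a
  map from the r-torus to the unordered configuration space; s such tori give a map from the torus
  of dimension s r to its s-th power.  Each vertex v with a pair of branches a, b carries a
  circle-valued function on the configuration space, which measures how often a particle passes
  from v into a while another one sits in b; on a torus as above it winds along the circle of the
  vertex v if its tripod uses a and b, and it lifts to the real line otherwise.

  The r vertices and the tripods are chosen for each of the s tori in such a way that every circle
  factor is detected by a function that is null-homotopic on some other of the s tori: a vertex of
  degree at least four offers two different tripods, and a vertex of degree three is left out of
  at least one of the tori, which is possible since l <= floor (k / s) (s - 1).  The quotient of the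
  function in the two coordinates lifts to the real line over every open set with a section of
  the path fibration, but winds along the chosen circle of the big torus.  A Lebesgue type argument
  based on Kuhn's lemma shows that s r such open sets, one for each circle, cannot cover the torus.
*)

theory Submission
  imports Defs
begin

text \<open>The classical route to such a bound is the zero-divisor cup length: \<open>s * r\<close>
  classes of degree one on the power of the space, each killed by the diagonal, with nonzero
  product. Here a class of degree one is a circle-valued function and the product is never formed:
  the covering theorem stands in for the nonvanishing of the top class of the torus.

  That theorem asks for a diagonal matrix of winding numbers. Comparing a function in two
  coordinates of the power would in general add windings along circles of both tori; if it lifts to
  the real line on the second torus, the chosen circle alone remains. The diagonal entry is 2,
  because a unit of time consists of two exchanges.

  The term floor(k / s)(s - 1) is a count: the vertices of degree three are cut into
  \<open>k div s\<close> groups of s, the j-th torus omits the j-th member of every group, and the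
  remainder is omitted everywhere. Subdivision keeps the stars of the chosen vertices
  disjoint.\<close>

section \<open>A covering theorem for the torus\<close>

lemma compact_unit_cube_nat:
  "compact {x :: nat \<Rightarrow> real. (\<forall>j<N. 0 \<le> x j \<and> x j \<le> 1) \<and> (\<forall>j\<ge>N. x j = 0)}"
proof -
  let ?C = "\<lambda>j::nat. if j < N then {0..1::real} else {0}"
  have "compactin (product_topology (\<lambda>_. euclideanreal) UNIV) (PiE UNIV ?C)"
    by (subst compactin_PiE) auto
  moreover have "PiE UNIV ?C =
      {x :: nat \<Rightarrow> real. (\<forall>j<N. 0 \<le> x j \<and> x j \<le> 1) \<and> (\<forall>j\<ge>N. x j = 0)}"
    by (auto simp: PiE_iff split: if_splits)
  ultimately show ?thesis
    by (simp add: euclidean_product_topology)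
qed

text \<open>The metric on sequences weights the coordinates by powers of 1/2, so coordinatewise
  closeness controls finitely many terms and the tail remains as \<open>(1/2)^N\<close>.\<close>

lemma dist_fun_le:
  fixes x y :: "nat \<Rightarrow> real"
  assumes "\<And>j. \<bar>x j - y j\<bar> \<le> \<delta>"
  shows "dist x y \<le> 2 * \<delta> + (1/2)^N"
proof -
  have "dist x y \<le> 2 * Max {dist (x (from_nat n)) (y (from_nat n))|n. n \<le> N} + (1/2)^N"
    by (rule dist_fun_le_dist_first_terms)
  moreover have "Max {dist (x (from_nat n)) (y (from_nat n))|n. n \<le> N} \<le> \<delta>"
    using assms by (subst Max_le_iff) (auto simp: dist_real_def)
  ultimately show ?thesis by linarith
qed

text \<open>On \<open>W i\<close> the difference of \<open>d * x i\<close> and \<open>k i\<close> is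
  periodic, hence a real primitive of d times the i-th coordinate class of the torus. So each of the
  N coordinate classes dies on one of the N sets, which would force their product, the top class, to
  vanish. The proof replaces this by Kuhn's lemma on a cube that spans many periods.\<close>

lemma periodic_cover_contradiction:
  fixes W :: "nat \<Rightarrow> (nat \<Rightarrow> real) set" and k :: "nat \<Rightarrow> (nat \<Rightarrow> real) \<Rightarrow> real" and d :: real
  assumes opn: "\<And>i. i < N \<Longrightarrow> open (W i)"
    and cov: "\<And>x. \<exists>i<N. x \<in> W i"
    and per: "\<And>i x z. i < N \<Longrightarrow> x \<in> W i \<Longrightarrow> (\<And>j. z j \<in> \<int>) \<Longrightarrow> (\<lambda>j. x j + z j) \<in> W i"
    and eqv: "\<And>i x z. i < N \<Longrightarrow> x \<in> W i \<Longrightarrow> (\<And>j. z j \<in> \<int>) \<Longrightarrow>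
                k i (\<lambda>j. x j + z j) = k i x + d * z i"
    and seg: "\<And>i x y. i < N \<Longrightarrow> (\<And>u. 0 \<le> u \<Longrightarrow> u \<le> 1 \<Longrightarrow> (\<lambda>j. (1 - u) * x j + u * y j) \<in> W i) \<Longrightarrow>
                k i x = k i y"
    and d: "0 < d"
  shows False
proof -
  define K where "K = {x :: nat \<Rightarrow> real. (\<forall>j<N. 0 \<le> x j \<and> x j \<le> 1) \<and> (\<forall>j\<ge>N. x j = 0)}"
  have "compact K"
    unfolding K_def by (rule compact_unit_cube_nat)
  moreover have "K \<subseteq> \<Union>(W ` {..<N})"
    using cov by blast
  ultimately obtain e where e: "0 < e" "\<And>x. x \<in> K \<Longrightarrow> \<exists>G \<in> W ` {..<N}. ball x e \<subseteq> G"
    by (rule Heine_Borel_lemma) (use opn in auto)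
  \<comment> \<open>With these choices \<open>2 * (1 / M) + (1/2)^M0 < e\<close>, so by
    \<open>dist_fun_le\<close> a grid box of side 1/M fits into a ball of radius e.\<close>
  obtain M0 where M0: "(1/2::real) ^ M0 < e / 2"
    using real_arch_pow_inv[of "e/2" "1/2"] e by auto
  obtain M :: nat where M: "0 < M" "1 / real M < e / 4"
    using real_arch_invD[of "e/4"] e by (auto simp: inverse_eq_divide)
  define box where "box = (\<lambda>q :: nat \<Rightarrow> nat. {y :: nat \<Rightarrow> real.
      (\<forall>j<N. real (q j) / M \<le> y j \<and> y j \<le> (real (q j) + 1) / M) \<and> (\<forall>j\<ge>N. y j = 0)})"
  define pt where "pt = (\<lambda>q :: nat \<Rightarrow> nat. \<lambda>j. if j < N then real (q j) / M else (0::real))"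
  have box0: "\<exists>i<N. box q \<subseteq> W i" if q: "\<forall>j<N. q j < M" for q
  proof -
    have "pt q \<in> K"
      using q M by (auto simp: K_def pt_def less_imp_le)
    then obtain i where i: "i < N" "ball (pt q) e \<subseteq> W i"
      using e by blast
    have "y \<in> ball (pt q) e" if "y \<in> box q" for y
    proof -
      have "\<bar>pt q j - y j\<bar> \<le> 1 / M" for j
        using that by (cases "j < N") (auto simp: pt_def box_def add_divide_distrib abs_le_iff)
      then have "dist (pt q) y \<le> 2 * (1 / M) + (1/2)^M0"
        by (rule dist_fun_le)
      also have "\<dots> < e"
        using M M0 by linarith
      finally show ?thesis by simp
    qed
    with i show ?thesis by blast
  qed
  \<comment> \<open>\<open>md q\<close> is the translate of the grid point \<open>q\<close> into the
    unit cube and \<open>zz q\<close> the integer vector between them. It is 0 from N on, so that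
    translated boxes keep their zero coordinates.\<close>
  define zz where "zz = (\<lambda>q :: nat \<Rightarrow> nat. \<lambda>j. if j < N then real (q j div M) else (0::real))"
  have zz: "zz q j \<in> \<int>" "- zz q j \<in> \<int>" for q j
    by (auto simp: zz_def)
  define md where "md = (\<lambda>q :: nat \<Rightarrow> nat. \<lambda>j. q j mod M)"
  have qeq: "real (q j) / M = real (q j div M) + real (q j mod M) / M" for q :: "nat \<Rightarrow> nat" and j
  proof -
    have "real (q j) = real (q j div M) * M + real (q j mod M)"
      by (metis div_mult_mod_eq of_nat_add of_nat_mult)
    then show ?thesis
      using M by (simp add: field_simps)
  qed
  have box: "\<exists>i<N. box q \<subseteq> W i" for q
  proof -
    obtain i where i: "i < N" "box (md q) \<subseteq> W i"
      using box0[of "md q"] M by (auto simp: md_def)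
    have "y \<in> W i" if "y \<in> box q" for y
    proof -
      have "(\<lambda>j. y j + - zz q j) \<in> box (md q)"
        using that qeq[of q] by (auto simp: box_def md_def zz_def add_divide_distrib algebra_simps)
      then have "(\<lambda>j. y j + - zz q j) \<in> W i"
        using i by blast
      from per[OF i(1) this, of "zz q"] zz show ?thesis by simp
    qed
    with i show ?thesis by blast
  qed
  have ptmd: "pt q = (\<lambda>j. pt (md q) j + zz q j)" for q
    using qeq[of q] by (auto simp: pt_def md_def zz_def)
  have ptmd': "pt (md q) = (\<lambda>j. pt q j + - zz q j)" for q
    by (subst (2) ptmd) simp
  have kmd: "k i (pt q) = k i (pt (md q)) + d * real (q i div M)" if "i < N" "pt q \<in> W i" for i q
  proof -
    have "pt (md q) \<in> W i"
      unfolding ptmd' by (rule per) (use that zz in auto)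
    then have "k i (\<lambda>j. pt (md q) j + zz q j) = k i (pt (md q)) + d * zz q i"
      by (rule eqv[OF that(1)]) (rule zz)
    then show ?thesis
      using that(1) unfolding ptmd[of q, symmetric] by (simp add: zz_def)
  qed
  let ?F = "PiE {..<N} (\<lambda>_. {..<M})"
  obtain B where B: "\<And>i q. i < N \<Longrightarrow> \<forall>j<N. q j < M \<Longrightarrow> \<bar>k i (pt q)\<bar> \<le> B"
  proof -
    have fin: "finite ((\<lambda>(i, q). \<bar>k i (pt q)\<bar>) ` ({..<N} \<times> ?F))"
      by (intro finite_imageI finite_SigmaI finite_PiE) auto
    show ?thesis
    proof (rule that[of "Max ((\<lambda>(i, q). \<bar>k i (pt q)\<bar>) ` ({..<N} \<times> ?F))"])
      fix i q assume "i < N" "\<forall>j<N. q j < M"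
      then have "(i, restrict q {..<N}) \<in> {..<N} \<times> ?F"
        by auto
      moreover have "pt q = pt (restrict q {..<N})"
        by (auto simp: pt_def)
      ultimately show "\<bar>k i (pt q)\<bar> \<le> Max ((\<lambda>(i, q). \<bar>k i (pt q)\<bar>) ` ({..<N} \<times> ?F))"
        by (intro Max_ge[OF fin] image_eqI[of _ _ "(i, restrict q {..<N})"]) simp_all
    qed
  qed
  \<comment> \<open>Crossing L periods in direction i raises \<open>k i\<close> by
    \<open>L * d\<close>, more than the spread of its values at the grid points of the unit
    cube.\<close>
  obtain L :: nat where L: "2 * \<bar>B\<bar> < L * d"
    using reals_Archimedean3[OF d] by blast
  have L0: "0 < L"
    using L d by (cases L) auto
  have kB: "\<bar>k i (pt (md q))\<bar> \<le> \<bar>B\<bar>" if "i < N" for i q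
    using B[OF that, of "md q"] M by (auto simp: md_def)
  \<comment> \<open>Inside \<open>W i\<close> the label says whether \<open>k i\<close> has passed
    the threshold; outside it is set to what Kuhn's lemma demands on the two faces.\<close>
  define lab where "lab = (\<lambda>(q :: nat \<Rightarrow> nat) i. if pt q \<in> W i
      then (if k i (pt q) > \<bar>B\<bar> then 1 else 0) else (if q i = L * M then 1 else (0::nat)))"
  have l0: "lab q i = 0" if "i < N" "q i = 0" for q i
    using kmd[OF that(1), of q] kB[OF that(1), of q] that L0 M by (auto simp: lab_def)
  have l1: "lab q i = 1" if "i < N" "q i = L * M" for q i
  proof -
    have "k i (pt q) > \<bar>B\<bar>" if "pt q \<in> W i"
    proof -
      have "k i (pt q) = k i (pt (md q)) + d * real L"
        using kmd[OF \<open>i < N\<close> that] \<open>q i = L * M\<close> M by simp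
      with kB[OF \<open>i < N\<close>, of q] L show ?thesis
        by (simp add: mult.commute)
    qed
    then show ?thesis
      using that by (auto simp: lab_def)
  qed
  obtain q where q: "\<forall>i<N. \<exists>r s. (\<forall>j<N. q j \<le> r j \<and> r j \<le> q j + 1) \<and>
      (\<forall>j<N. q j \<le> s j \<and> s j \<le> q j + 1) \<and> lab r i \<noteq> lab s i"
  proof (rule kuhn_lemma[of "L * M" N lab])
    show "0 < L * M" using L0 M by simp
  qed (use l0 l1 in \<open>auto simp: lab_def\<close>)
  \<comment> \<open>The cell found by Kuhn's lemma is a box, so it lies in a single
    \<open>W i\<close>. There \<open>k i\<close> agrees at all corners, and the i-th label cannot
    change.\<close>
  obtain i where i: "i < N" "box q \<subseteq> W i"
    using box by blast
  obtain r s where r: "\<forall>j<N. q j \<le> r j \<and> r j \<le> q j + 1" and s: "\<forall>j<N. q j \<le> s j \<and> s j \<le> q j + 1"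
    and rs: "lab r i \<noteq> lab s i"
    using q i by blast
  have ptbox: "pt r \<in> box q" if "\<forall>j<N. q j \<le> r j \<and> r j \<le> q j + 1" for r
  proof -
    have "real (q j) \<le> real (r j)" "real (r j) \<le> real (q j) + 1" if "j < N" for j
      using \<open>\<forall>j<N. _ j \<le> r j \<and> _\<close> that by (metis of_nat_le_iff of_nat_Suc Suc_eq_plus1 add.commute)+
    then show ?thesis
      by (auto simp: pt_def box_def intro!: divide_right_mono)
  qed
  have conv: "(1 - u) * a + u * b \<in> {x..y}" if "a \<in> {x..y}" "b \<in> {x..y}" "0 \<le> u" "u \<le> 1"
    for a b u x y :: real
    using convexD_alt[OF convex_real_interval(5)[of x y] that(1,2,3,4)] by simp
  have "k i (pt r) = k i (pt s)"
  proof (rule seg[OF i(1)])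
    fix u :: real assume "0 \<le> u" "u \<le> 1"
    then have "(1 - u) * pt r j + u * pt s j \<in> {real (q j) / M..(real (q j) + 1) / M}" if "j < N" for j
      using ptbox[OF r] ptbox[OF s] that by (intro conv) (auto simp: box_def)
    moreover have "(1 - u) * pt r j + u * pt s j = 0" if "N \<le> j" for j
      using that by (simp add: pt_def)
    ultimately have "(\<lambda>j. (1 - u) * pt r j + u * pt s j) \<in> box q"
      by (simp add: box_def)
    then show "(\<lambda>j. (1 - u) * pt r j + u * pt s j) \<in> W i"
      using i by blast
  qed
  moreover have "pt r \<in> W i" "pt s \<in> W i"
    using ptbox[OF r] ptbox[OF s] i by auto
  ultimately show False
    using rs by (auto simp: lab_def)
qed

section \<open>Tori in powers of a space and higher topological complexity\<close>

lemma integer_valued_continuous_constant: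
  fixes f :: "'c::topological_space \<Rightarrow> real"
  assumes "continuous_on S f" "connected S" "\<And>x. x \<in> S \<Longrightarrow> f x \<in> \<int>" "x \<in> S" "y \<in> S"
  shows "f x = f y"
proof -
  have "f constant_on S"
  proof (rule continuous_discrete_range_constant[OF assms(2,1)])
    fix x assume x: "x \<in> S"
    have "1 \<le> norm (f y - f x)" if "y \<in> S" "f y \<noteq> f x" for y
    proof -
      have "f y - f x \<in> \<int>" "f y - f x \<noteq> 0"
        using assms(3) x that by auto
      then show ?thesis
        by (simp add: Ints_nonzero_abs_ge1)
    qed
    then show "\<exists>e>0. \<forall>y. y \<in> S \<and> f y \<noteq> f x \<longrightarrow> e \<le> norm (f y - f x)"
      by (intro exI[of _ 1]) auto
  qed
  then show ?thesis
    using assms(4,5) by (auto simp: constant_on_def)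
qed

text \<open>Evaluation is jointly continuous in the compact-open topology because the interval is
  locally compact: a compact neighbourhood \<open>K\<close> of the given time is mapped into the
  given open set by all nearby paths.\<close>

lemma continuous_on_path_space_eval:
  fixes S :: "'c::topological_space set" and a :: "'b \<Rightarrow> 'd::topological_space"
  assumes c: "continuous_map (top_of_set S) (path_space X) c" and a: "continuous_map X euclidean a"
  shows "continuous_on (S \<times> {0..1}) (\<lambda>(u, \<tau>). a (c u \<tau>))"
  unfolding continuous_on_topological
proof (intro ballI allI impI)
  fix w B
  assume w: "w \<in> S \<times> {0..1::real}" and B: "open B" "(case w of (u, \<tau>) \<Rightarrow> a (c u \<tau>)) \<in> B"
  obtain u0 t0 where w0: "w = (u0, t0)" "u0 \<in> S" "t0 \<in> {0..1}" "a (c u0 t0) \<in> B"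
    using w B by (cases w) auto
  define O' where "O' = {x \<in> topspace X. a x \<in> B}"
  have O': "openin X O'"
    unfolding O'_def using a B by (intro openin_continuous_map_preimage[OF a]) auto
  have cp: "c u \<in> paths X" if "u \<in> S" for u
    using continuous_map_funspace[OF c] that by (auto simp: topspace_path_space)
  then have p: "continuous_map (top_of_set {0..1}) X (c u0)"
    using w0 by (auto simp: paths_def pathin_def)
  have "openin (top_of_set {0..1}) {t \<in> {0..1}. c u0 t \<in> O'}"
    using openin_continuous_map_preimage[OF p O'] by simp
  moreover have "t0 \<in> {t \<in> {0..1}. c u0 t \<in> O'}"
    using w0 continuous_map_funspace[OF p] by (auto simp: O'_def)
  ultimately obtain e where e: "0 < e" "ball t0 e \<inter> {0..1} \<subseteq> {t \<in> {0..1}. c u0 t \<in> O'}"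
    unfolding openin_contains_ball by blast
  define K where "K = cball t0 (e/2) \<inter> {0..1}"
  have K: "compact K" "K \<subseteq> {0..1}"
    by (auto simp: K_def compact_Int)
  have "K \<subseteq> ball t0 e \<inter> {0..1}"
    using e by (auto simp: K_def)
  with e have KO: "c u0 ` K \<subseteq> O'"
    by blast
  have "openin (path_space X) {\<gamma> \<in> paths X. \<gamma> ` K \<subseteq> O'}"
    unfolding path_space_def using K O' by (intro topology_generated_by_Basis) blast
  from openin_continuous_map_preimage[OF c this]
  have "openin (top_of_set S) {u \<in> S. c u \<in> paths X \<and> c u ` K \<subseteq> O'}"
    by simp
  then obtain A where A: "open A" "{u \<in> S. c u \<in> paths X \<and> c u ` K \<subseteq> O'} = S \<inter> A"
    unfolding openin_open by auto
  show "\<exists>A. open A \<and> w \<in> A \<and> (\<forall>y\<in>S \<times> {0..1}. y \<in> A \<longrightarrow> (case y of (u, \<tau>) \<Rightarrow> a (c u \<tau>)) \<in> B)"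
  proof (intro exI conjI ballI impI)
    show "open (A \<times> ball t0 (e/2))"
      using A by (intro open_Times) auto
    show "w \<in> A \<times> ball t0 (e/2)"
      using A w0 cp KO e by auto
    fix y assume y: "y \<in> S \<times> {0..1::real}" "y \<in> A \<times> ball t0 (e/2)"
    obtain u t where ut: "y = (u, t)" by (cases y)
    have "u \<in> S \<inter> A" "t \<in> K"
      using y ut by (auto simp: K_def)
    then have "c u t \<in> O'"
      using A by blast
    then show "(case y of (u, \<tau>) \<Rightarrow> a (c u \<tau>)) \<in> B"
      by (simp add: ut O'_def)
  qed
qed

text \<open>Well defined, because two continuous logarithms of \<open>f\<close> differ by a constant.\<close>

definition log_change :: "(real \<Rightarrow> complex) \<Rightarrow> real \<Rightarrow> real \<Rightarrow> complex" where
  "log_change f a b = (SOME D. \<exists>g. continuous_on {0..1} g \<and> (\<forall>t\<in>{0..1}. f t = exp (g t)) \<and> D = g b - g a)"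

lemma log_change_eq:
  assumes g: "continuous_on {0..1} g" "\<And>t. t \<in> {0..1} \<Longrightarrow> f t = exp (g t)"
    and ab: "a \<in> {0..1}" "b \<in> {0..1}"
  shows "log_change f a b = g b - g a"
  unfolding log_change_def
proof (rule some_equality)
  show "\<exists>g'. continuous_on {0..1} g' \<and> (\<forall>t\<in>{0..1}. f t = exp (g' t)) \<and> g b - g a = g' b - g' a"
    using g by blast
next
  fix D assume "\<exists>g'. continuous_on {0..1} g' \<and> (\<forall>t\<in>{0..1}. f t = exp (g' t)) \<and> D = g' b - g' a"
  then obtain g' where g': "continuous_on {0..1} g'" "\<And>t. t \<in> {0..1} \<Longrightarrow> f t = exp (g' t)" "D = g' b - g' a"
    by blast
  have per: "\<exists>n::int. g t = g' t + of_int (2 * n) * of_real pi * \<i>" if "t \<in> {0..1}" for t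
    using g(2)[OF that] g'(2)[OF that] exp_eq[of "g t" "g' t"] by auto
  have re: "Re (g t) = Re (g' t)" if "t \<in> {0..1}" for t
    using per[OF that] by auto
  have "(Im (g t) - Im (g' t)) / (2 * pi) \<in> \<int>" if "t \<in> {0..1}" for t
    using per[OF that] by (auto simp: field_simps)
  then have "(Im (g a) - Im (g' a)) / (2 * pi) = (Im (g b) - Im (g' b)) / (2 * pi)"
    by (intro integer_valued_continuous_constant[where S="{0..1}"] continuous_intros g g') (use ab in auto)
  then have "Im (g b - g a) = Im D"
    unfolding g'(3) by simp
  with re ab g' show "D = g b - g a"
    by (auto simp: complex_eq_iff)
qed

lemma contractible_square: "contractible ({0..1::real} \<times> {0..1::real})"
  by (intro convex_imp_contractible convex_Times) auto

text \<open>One logarithm exists on the whole contractible square and computes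
  \<open>log_change\<close> on every vertical line. As \<open>log_change\<close> is defined line by
  line, it depends on the path alone and not on the square chosen around it.\<close>

lemma continuous_log_square:
  fixes F :: "real \<times> real \<Rightarrow> complex"
  assumes "continuous_on ({0..1} \<times> {0..1}) F" "\<And>z. z \<in> {0..1} \<times> {0..1} \<Longrightarrow> F z \<noteq> 0"
    and ab: "a \<in> {0..1}" "b \<in> {0..1}"
  shows "continuous_on {0..1} (\<lambda>u. log_change (\<lambda>t. F (u, t)) a b)"
    and "\<And>u. u \<in> {0..1} \<Longrightarrow> F (u, b) = exp (log_change (\<lambda>t. F (u, t)) a b) * F (u, a)"
proof -
  obtain g where g: "continuous_on ({0..1} \<times> {0..1}) g" "\<And>z. z \<in> {0..1} \<times> {0..1} \<Longrightarrow> F z = exp (g z)"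
    using continuous_logarithm_on_contractible[OF assms(1) contractible_square] assms(2) by blast
  have eq: "log_change (\<lambda>t. F (u, t)) a b = g (u, b) - g (u, a)" if "u \<in> {0..1}" for u
    using that ab g(2)
    by (intro log_change_eq[where g = "\<lambda>t. g (u, t)"] continuous_on_compose2[OF g(1)] continuous_intros) auto
  have "continuous_on {0..1} (\<lambda>u. g (u, b) - g (u, a))"
    using ab by (intro continuous_intros continuous_on_compose2[OF g(1)]) auto
  then show "continuous_on {0..1} (\<lambda>u. log_change (\<lambda>t. F (u, t)) a b)"
    by (rule continuous_on_eq) (simp add: eq)
  show "F (u, b) = exp (log_change (\<lambda>t. F (u, t)) a b) * F (u, a)" if "u \<in> {0..1}" for u
    using that ab by (simp add: eq g(2) exp_diff)
qed

text \<open>Over a set with a section, a path joins the coordinates \<open>q i\<close> and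
  \<open>p i\<close>. The change of the logarithm of \<open>a i\<close> along it is a second
  logarithm of the quotient of the two values, and a periodic one, since it depends on
  \<open>\<Phi> x\<close> alone. It differs from \<open>h i\<close> by an integer, and this integer
  inherits the winding of \<open>h i\<close>.\<close>

lemma TC_ge_of_torus_map:
  fixes X :: "'b topology" and \<Phi> :: "(nat \<Rightarrow> real) \<Rightarrow> nat \<Rightarrow> 'b" and a :: "nat \<Rightarrow> 'b \<Rightarrow> complex"
    and h :: "nat \<Rightarrow> (nat \<Rightarrow> real) \<Rightarrow> real"
  assumes s: "2 \<le> s"
    and \<Phi>: "continuous_map euclidean (power_space s X) \<Phi>"
    and \<Phi>per: "\<And>x z. (\<And>j. z j \<in> \<int>) \<Longrightarrow> \<Phi> (\<lambda>j. x j + z j) = \<Phi> x"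
    and a: "\<And>i. i < N \<Longrightarrow> continuous_map X euclidean (a i)"
    and a0: "\<And>i x. i < N \<Longrightarrow> x \<in> topspace X \<Longrightarrow> a i x \<noteq> 0"
    and pq: "\<And>i. i < N \<Longrightarrow> p i < s" "\<And>i. i < N \<Longrightarrow> q i < s"
    and h: "\<And>i. i < N \<Longrightarrow> continuous_on UNIV (h i)"
    and ah: "\<And>i x. i < N \<Longrightarrow> a i (\<Phi> x (p i)) = cis (2 * pi * h i x) * a i (\<Phi> x (q i))"
    and hper: "\<And>i x z. i < N \<Longrightarrow> (\<And>j. z j \<in> \<int>) \<Longrightarrow> h i (\<lambda>j. x j + z j) = h i x + d * z i"
    and d: "0 < d"
  shows "enat N \<le> TC s X"
proof -
  have "enat (Suc N) \<le> TC_cover_number s X"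
    unfolding TC_cover_number_def
  proof (rule Inf_greatest)
    fix m
    assume "m \<in> {enat (card \<U>) | \<U>. finite \<U> \<and> \<Union>\<U> = topspace (power_space s X) \<and>
            (\<forall>U\<in>\<U>. openin (power_space s X) U \<and> admits_section s X U)}"
    then obtain \<U> where m: "m = enat (card \<U>)" and fin: "finite \<U>"
      and cov: "\<Union>\<U> = topspace (power_space s X)"
      and op: "\<And>U. U \<in> \<U> \<Longrightarrow> openin (power_space s X) U"
      and sec: "\<And>U. U \<in> \<U> \<Longrightarrow> admits_section s X U"
      by blast
    have \<Phi>top: "\<Phi> x \<in> topspace (power_space s X)" for x
      using continuous_map_funspace[OF \<Phi>] by auto
    show "enat (Suc N) \<le> m"
    proof (rule ccontr)
      assume "\<not> enat (Suc N) \<le> m"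
      then have card: "card \<U> \<le> N"
        using m by simp
      obtain f0 where f0: "bij_betw f0 {0..<card \<U>} \<U>"
        using ex_bij_betw_nat_finite[OF fin] by blast
      have ne: "0 < card \<U>"
        using fin cov \<Phi>top by (auto simp: card_gt_0_iff)
      \<comment> \<open>A cover by fewer than N sets is padded with repetitions, because the
        covering theorem takes one set for each direction.\<close>
      define U where "U = (\<lambda>i. if i < card \<U> then f0 i else f0 0)"
      have U\<U>: "U i \<in> \<U>" for i
        using f0 ne by (auto simp: U_def bij_betw_def)
      have "\<exists>\<sigma>. continuous_map (subtopology (power_space s X) (U i)) (path_space X) \<sigma> \<and>
          (\<forall>x\<in>U i. path_eval s (\<sigma> x) = x)" for i
        using sec[OF U\<U>[of i]] by (simp add: admits_section_def)
      then obtain \<sigma> where \<sigma>: "\<And>i. continuous_map (subtopology (power_space s X) (U i)) (path_space X) (\<sigma> i)"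
        and ev: "\<And>i x. x \<in> U i \<Longrightarrow> path_eval s (\<sigma> i x) = x"
        by metis
      define \<tau> where "\<tau> = (\<lambda>j. real j / (real s - 1))"
      have \<tau>: "\<tau> j \<in> {0..1}" if "j < s" for j
        using that s by (auto simp: \<tau>_def field_simps)
      have ev': "\<sigma> i x (\<tau> j) = x j" if "x \<in> U i" "j < s" for i x j
        using fun_cong[OF ev[OF that(1)], of j] that(2) by (simp add: path_eval_def \<tau>_def)
      define W where "W = (\<lambda>i. {x. \<Phi> x \<in> U i})"
      define D where "D = (\<lambda>i x. log_change (\<lambda>t. a i (\<sigma> i (\<Phi> x) t)) (\<tau> (q i)) (\<tau> (p i)))"
      define k where "k = (\<lambda>i x. h i x - Im (D i x) / (2 * pi))"
      \<comment> \<open>Over a segment the section yields a map from a square, so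
        \<open>continuous_log_square\<close> applies; an integer-valued continuous function is then
        constant along the segment.\<close>
      have seg: "continuous_on {0..1} (\<lambda>u. k i (\<lambda>j. (1 - u) * x j + u * y j)) \<and>
          (\<forall>u\<in>{0..1}. k i (\<lambda>j. (1 - u) * x j + u * y j) \<in> \<int>)"
        if i: "i < N" and xy: "\<And>u. 0 \<le> u \<Longrightarrow> u \<le> 1 \<Longrightarrow> (\<lambda>j. (1 - u) * x j + u * y j) \<in> W i" for i x y
      proof -
        define \<theta> where "\<theta> = (\<lambda>(u::real) (j::nat). (1 - u) * x j + u * y j)"
        have \<theta>: "continuous_on S \<theta>" for S
          unfolding \<theta>_def by (intro continuous_on_coordinatewise_then_product continuous_intros)
        have \<theta>W: "\<Phi> (\<theta> u) \<in> U i" if "u \<in> {0..1}" for u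
          using xy[of u] that by (simp add: \<theta>_def W_def)
        have "continuous_map (top_of_set {0..1}) (subtopology (power_space s X) (U i)) (\<Phi> \<circ> \<theta>)"
          unfolding continuous_map_in_subtopology
          using \<theta>W by (auto intro!: continuous_map_compose[OF _ \<Phi>] simp: \<theta>)
        from continuous_map_compose[OF this \<sigma>]
        have cc: "continuous_map (top_of_set {0..1}) (path_space X) (\<lambda>u. \<sigma> i (\<Phi> (\<theta> u)))"
          by (simp add: o_def)
        define F where "F = (\<lambda>(u, t). a i (\<sigma> i (\<Phi> (\<theta> u)) t))"
        have F: "continuous_on ({0..1} \<times> {0..1}) F"
          unfolding F_def by (rule continuous_on_path_space_eval[OF cc a[OF i]])
        have F0: "F z \<noteq> 0" if z: "z \<in> {0..1} \<times> {0..1}" for z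
        proof -
          obtain u t where ut: "z = (u, t)" "u \<in> {0..1}" "t \<in> {0..1}"
            using z by auto
          then have "\<sigma> i (\<Phi> (\<theta> u)) \<in> paths X"
            using continuous_map_funspace[OF cc] by (auto simp: topspace_path_space)
          then have "continuous_map (top_of_set {0..1}) X (\<sigma> i (\<Phi> (\<theta> u)))"
            by (simp add: paths_def pathin_def)
          from continuous_map_funspace[OF this] have "\<sigma> i (\<Phi> (\<theta> u)) t \<in> topspace X"
            using ut by auto
          then show ?thesis
            using a0[OF i] ut by (simp add: F_def)
        qed
        have L1: "continuous_on {0..1} (\<lambda>u. log_change (\<lambda>t. F (u, t)) (\<tau> (q i)) (\<tau> (p i)))"
          by (rule continuous_log_square(1)[OF F]) (use F0 \<tau> pq i in blast)+
        have L2: "F (u, \<tau> (p i)) = exp (log_change (\<lambda>t. F (u, t)) (\<tau> (q i)) (\<tau> (p i))) * F (u, \<tau> (q i))"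
          if "u \<in> {0..1}" for u
          by (rule continuous_log_square(2)[OF F]) (use F0 \<tau> pq i that in blast)+
        have h\<theta>: "continuous_on {0..1} (\<lambda>u. h i (\<theta> u))"
          by (rule continuous_on_compose2[OF h[OF i] \<theta>]) simp
        have DF: "D i (\<theta> u) = log_change (\<lambda>t. F (u, t)) (\<tau> (q i)) (\<tau> (p i))" for u
          by (simp add: D_def F_def)
        have "continuous_on {0..1} (\<lambda>u. k i (\<theta> u))"
          unfolding k_def DF
          by (intro continuous_intros L1 h\<theta>) simp
        moreover have "k i (\<theta> u) \<in> \<int>" if u: "u \<in> {0..1}" for u
        proof -
          have Fp: "F (u, \<tau> j) = a i (\<Phi> (\<theta> u) j)" if "j < s" for j
            using ev'[OF \<theta>W[OF u] that] by (simp add: F_def)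
          have "F (u, \<tau> (q i)) \<noteq> 0"
            using F0 u \<tau>[OF pq(2)[OF i]] by blast
          moreover have "F (u, \<tau> (p i)) = cis (2 * pi * h i (\<theta> u)) * F (u, \<tau> (q i))"
            using ah[OF i] pq i by (simp add: Fp)
          ultimately have "exp (D i (\<theta> u)) = exp (\<i> * of_real (2 * pi * h i (\<theta> u)))"
            using L2[OF u] by (simp add: DF cis_conv_exp)
          then obtain n :: int where "D i (\<theta> u) = \<i> * of_real (2 * pi * h i (\<theta> u)) + of_int (2 * n) * of_real pi * \<i>"
            unfolding exp_eq by auto
          then have "Im (D i (\<theta> u)) = 2 * pi * h i (\<theta> u) + 2 * pi * of_int n"
            by simp
          then have "k i (\<theta> u) = - of_int n"
            by (simp add: k_def field_simps)
          then show ?thesis by simp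
        qed
        ultimately show ?thesis
          by (simp add: \<theta>_def)
      qed
      show False
      proof (rule periodic_cover_contradiction[of N W k d])
        fix i assume i: "i < N"
        have "openin euclidean {x \<in> topspace euclidean. \<Phi> x \<in> U i}"
          by (rule openin_continuous_map_preimage[OF \<Phi> op[OF U\<U>]])
        then show "open (W i)"
          by (simp add: W_def)
        fix x y assume "\<And>u. 0 \<le> u \<Longrightarrow> u \<le> 1 \<Longrightarrow> (\<lambda>j. (1 - u) * x j + u * y j) \<in> W i"
        from seg[OF i this] have "k i (\<lambda>j. (1 - 0) * x j + 0 * y j) = k i (\<lambda>j. (1 - 1) * x j + 1 * y j)"
          by (intro integer_valued_continuous_constant[where S = "{0..1}"
                and f = "\<lambda>u. k i (\<lambda>j. (1 - u) * x j + u * y j)"]) auto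
        then show "k i x = k i y" by simp
      next
        fix x
        obtain V where "V \<in> \<U>" "\<Phi> x \<in> V"
          using \<Phi>top cov by blast
        then obtain i where "i < card \<U>" "f0 i = V"
          using bij_betw_imp_surj_on[OF f0] by (metis atLeastLessThan_iff imageE)
        then show "\<exists>i<N. x \<in> W i"
          using card \<open>\<Phi> x \<in> V\<close> by (intro exI[of _ i]) (auto simp: W_def U_def)
      next
        fix i x and z :: "nat \<Rightarrow> real" assume i: "i < N" and x: "x \<in> W i" and z: "\<And>j. z j \<in> \<int>"
        show "(\<lambda>j. x j + z j) \<in> W i"
          using x z by (simp add: W_def \<Phi>per)
        show "k i (\<lambda>j. x j + z j) = k i x + d * z i"
          using i z by (simp add: k_def D_def \<Phi>per hper)
      qed (use d in auto)
    qed
  qed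
  then show ?thesis
    unfolding TC_def by (cases "TC_cover_number s X") (auto simp: one_enat_def)
qed

section \<open>Exchanging two particles at a vertex with three arms\<close>

text \<open>Two adjacent unit intervals fit together at an integer because of
  \<open>g 1 = g 0 + d\<close>. The case d = 0 serves the arm weights, d = 1 the lift of the
  exchange.\<close>

lemma continuous_periodic_extension:
  fixes g :: "real \<Rightarrow> real"
  assumes g: "continuous_on {0..1} g" and d: "g 1 = g 0 + d"
  shows "continuous_on UNIV (\<lambda>t. d * of_int \<lfloor>t\<rfloor> + g (frac t))"
proof -
  let ?G = "\<lambda>t. d * of_int \<lfloor>t\<rfloor> + g (frac t)"
  have cont: "continuous_on {of_int n..of_int n + 1} ?G" for n :: int
  proof (rule continuous_on_eq)
    show "continuous_on {of_int n..of_int n + 1} (\<lambda>t. d * of_int n + g (t - of_int n))"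
      by (intro continuous_intros continuous_on_compose2[OF g]) auto
    fix t assume t: "t \<in> {real_of_int n..real_of_int n + 1}"
    show "d * of_int n + g (t - of_int n) = ?G t"
    proof (cases "t = of_int n + 1")
      case True
      then have "\<lfloor>t\<rfloor> = n + 1"
        by linarith
      then show ?thesis
        using True d by (simp add: frac_def algebra_simps)
    next
      case False
      then have "\<lfloor>t\<rfloor> = n"
        using t by (simp add: floor_eq_iff)
      then show ?thesis
        by (simp add: frac_def)
    qed
  qed
  have "isCont ?G t" for t
  proof -
    let ?n = "\<lfloor>t\<rfloor>"
    have "continuous_on ({of_int (?n - 1)..of_int (?n - 1) + 1} \<union> {of_int ?n..of_int ?n + 1}) ?G"
      by (intro continuous_on_closed_Un cont) auto
    moreover have "{of_int (?n - 1)..of_int (?n - 1) + 1} \<union> {of_int ?n..of_int ?n + 1} =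
        {real_of_int ?n - 1..of_int ?n + 1}"
      by auto
    moreover have "t \<in> interior {real_of_int ?n - 1..of_int ?n + 1}"
      unfolding interior_atLeastAtMost_real by simp linarith
    ultimately show ?thesis
      by (simp add: continuous_on_interior)
  qed
  then show ?thesis
    by (simp add: continuous_at_imp_continuous_on)
qed

text \<open>
  A particle circulates through a vertex with three arms: on the time intervals \<open>[0, 2]\<close>,
  \<open>[2, 4]\<close>, \<open>[4, 6]\<close> (modulo 6, rescaled to period 1) it visits the ends of the arms with
  index 1, 3, 5, and \<open>arm_weight c t\<close> is its barycentric coordinate at the end of arm \<open>c\<close>.
  A second particle follows half a period later, so that one of the two always rests at the end
  of an arm.
\<close>

definition bump :: "real \<Rightarrow> real" where
  "bump x = max 0 (min 1 (2 - 2 * \<bar>x\<bar>))"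

definition arm_weight :: "real \<Rightarrow> real \<Rightarrow> real" where
  "arm_weight c t = bump (6 * frac t - c)"

definition centre_weight :: "real \<Rightarrow> real" where
  "centre_weight t = 1 - arm_weight 1 t - arm_weight 3 t - arm_weight 5 t"

text \<open>The ramp rises while \<open>6 * frac t\<close> runs from 2 to 5/2: the first particle
  goes from the centre to arm 3 and the second rests at arm 5. When the first one leaves arm 3
  again, the second rests at arm 1, so the gain is not undone.\<close>

definition exchange_lift :: "real \<Rightarrow> real" where
  "exchange_lift t = of_int \<lfloor>t\<rfloor> + max 0 (min 1 (12 * frac t - 4))"

lemma bump_range: "0 \<le> bump x" "bump x \<le> 1"
  by (auto simp: bump_def)

lemma bump_eq_0: "1 \<le> \<bar>x\<bar> \<Longrightarrow> bump x = 0"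
  by (auto simp: bump_def)

lemma arm_weight_range: "0 \<le> arm_weight c t" "arm_weight c t \<le> 1"
  by (auto simp: arm_weight_def bump_range)

lemma continuous_arm_weight:
  assumes "c \<in> {1, 3, 5}"
  shows "continuous_on UNIV (arm_weight c)"
proof -
  have "continuous_on UNIV (\<lambda>t. 0 * of_int \<lfloor>t\<rfloor> + bump (6 * frac t - c))"
    by (rule continuous_periodic_extension[where g = "\<lambda>x. bump (6 * x - c)"])
      (use assms in \<open>auto simp: bump_def intro!: continuous_intros\<close>)
  then show ?thesis
    by (simp add: arm_weight_def[abs_def])
qed

lemma continuous_exchange_lift: "continuous_on UNIV exchange_lift"
proof -
  have "continuous_on UNIV (\<lambda>t. 1 * of_int \<lfloor>t\<rfloor> + max 0 (min 1 (12 * frac t - 4)) :: real)"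
    by (rule continuous_periodic_extension[where g = "\<lambda>x. max 0 (min 1 (12 * x - 4))"])
      (auto intro!: continuous_intros)
  then show ?thesis
    by (simp add: exchange_lift_def[abs_def])
qed

lemma frac_add_Ints: "z \<in> \<int> \<Longrightarrow> frac (t + z) = frac (t :: real)"
  by (auto simp: frac_def elim!: Ints_cases)

lemma arm_weight_add_Ints: "z \<in> \<int> \<Longrightarrow> arm_weight c (t + z) = arm_weight c t"
  by (simp add: arm_weight_def frac_add_Ints)

lemma exchange_lift_add_Ints: "z \<in> \<int> \<Longrightarrow> exchange_lift (t + z) = exchange_lift t + z"
  by (auto simp: exchange_lift_def frac_add_Ints elim!: Ints_cases)

lemma arm_weight_disjoint:
  assumes "c \<in> {1, 3, 5}" "c' \<in> {1, 3, 5}" "c \<noteq> c'"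
  shows "arm_weight c t = 0 \<or> arm_weight c' t = 0"
proof -
  have "1 \<le> \<bar>6 * frac t - c\<bar> \<or> 1 \<le> \<bar>6 * frac t - c'\<bar>"
    using assms by auto
  then show ?thesis
    by (auto simp: arm_weight_def bump_eq_0)
qed

lemma centre_weight_nonneg: "0 \<le> centre_weight t"
  using arm_weight_disjoint[of 1 3 t] arm_weight_disjoint[of 1 5 t] arm_weight_disjoint[of 3 5 t]
    arm_weight_range[of 1 t] arm_weight_range[of 3 t] arm_weight_range[of 5 t]
  by (auto simp: centre_weight_def)

lemma frac_half: "frac (t + 1/2) = (if frac t < 1/2 then frac t + 1/2 else frac t - 1/2)" for t :: real
proof -
  have "frac (1/2 :: real) = 1/2"
    by (simp add: frac_eq)
  then show ?thesis
    by (simp add: frac_add)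
qed

text \<open>In time rescaled to period 6, plateaus of length 1 alternate with gaps of length 1, and
  half a period is the odd number 3; so the shift carries gaps to plateaus. The witness in each case
  is the arm of the plateau.\<close>

lemma arm_weight_resting:
  "\<exists>c\<in>{1, 3, 5}. arm_weight c t = 1 \<and> arm_weight c (t + 1/2) = 0 \<or>
                  arm_weight c (t + 1/2) = 1 \<and> arm_weight c t = 0"
proof -
  define x where "x = 6 * frac t"
  define y where "y = 6 * frac (t + 1/2)"
  have x: "0 \<le> x" "x < 6"
    using frac_lt_1[of t] by (auto simp: x_def)
  have y: "y = (if x < 3 then x + 3 else x - 3)"
    by (simp add: x_def y_def frac_half)
  consider "x \<le> 1/2" | "1/2 \<le> x \<and> x \<le> 3/2" | "3/2 \<le> x \<and> x \<le> 5/2" | "5/2 \<le> x \<and> x \<le> 7/2"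
    | "7/2 \<le> x \<and> x \<le> 9/2" | "9/2 \<le> x \<and> x \<le> 11/2" | "11/2 \<le> x"
    by linarith
  then have "\<exists>c\<in>{1, 3, 5}. bump (x - c) = 1 \<and> bump (y - c) = 0 \<or> bump (y - c) = 1 \<and> bump (x - c) = 0"
  proof cases
    case 1
    then show ?thesis using x y by (intro bexI[of _ 3] disjI2) (auto simp: bump_def min_def abs_if)
  next
    case 2
    then show ?thesis using x y by (intro bexI[of _ 1] disjI1) (auto simp: bump_def min_def abs_if)
  next
    case 3
    then show ?thesis using x y by (intro bexI[of _ 5] disjI2) (auto simp: bump_def min_def abs_if)
  next
    case 4
    then show ?thesis using x y by (intro bexI[of _ 3] disjI1) (auto simp: bump_def min_def abs_if)
  next
    case 5
    then show ?thesis using x y by (intro bexI[of _ 1] disjI2) (auto simp: bump_def min_def abs_if)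
  next
    case 6
    then show ?thesis using x y by (intro bexI[of _ 5] disjI1) (auto simp: bump_def min_def abs_if)
  next
    case 7
    then show ?thesis using x y by (intro bexI[of _ 3] disjI2) (auto simp: bump_def min_def abs_if)
  qed
  then show ?thesis
    by (simp add: arm_weight_def x_def y_def)
qed

text \<open>With x = \<open>6 * frac t\<close>, one factor of the product vanishes unless 2 < x < 3.
  Up to 5/2 the second particle rests at arm 5 and the product is the ramp itself. After 5/2 the
  lift is an integer and the first particle rests; the first alternative then holds only as long as
  the second has not left arm 5, that is, with product 1.\<close>

lemma exchange_lift_mod_1:
  "if centre_weight (t + 1/2) \<le> centre_weight t
   then arm_weight 3 t * arm_weight 5 (t + 1/2) - exchange_lift t \<in> \<int>
   else exchange_lift t \<in> \<int>"
proof -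
  define x where "x = 6 * frac t"
  define y where "y = 6 * frac (t + 1/2)"
  have x: "0 \<le> x" "x < 6"
    using frac_lt_1[of t] by (auto simp: x_def)
  have y: "y = (if x < 3 then x + 3 else x - 3)"
    by (simp add: x_def y_def frac_half)
  have H: "exchange_lift t = of_int \<lfloor>t\<rfloor> + max 0 (min 1 (2 * x - 4))"
    by (simp add: exchange_lift_def x_def)
  have wt: "arm_weight c t = bump (x - c)" "arm_weight c (t + 1/2) = bump (y - c)" for c
    by (simp_all add: arm_weight_def x_def y_def)
  have n1: "0 \<le> centre_weight t"
    by (rule centre_weight_nonneg)
  consider "x \<le> 2" | "2 \<le> x \<and> x \<le> 5/2" | "5/2 \<le> x \<and> x < 3" | "3 \<le> x"
    by linarith
  then show ?thesis
  proof cases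
    case 1
    then have "bump (x - 3) = 0" "exchange_lift t \<in> \<int>"
      using x H by (auto simp: bump_def)
    then show ?thesis
      by (simp add: wt)
  next
    case 2
    then have b: "bump (y - 5) = 1" "bump (y - 3) = 0" "bump (y - 1) = 0" "bump (x - 3) = 2 * x - 4"
      using y by (auto simp: bump_def)
    have "centre_weight (t + 1/2) = 0"
      by (simp add: centre_weight_def wt b)
    moreover have "exchange_lift t = of_int \<lfloor>t\<rfloor> + (2 * x - 4)"
      using 2 by (simp add: H)
    ultimately show ?thesis
      using n1 by (simp add: wt b)
  next
    case 3
    then have b: "bump (x - 3) = 1" "bump (x - 1) = 0" "bump (x - 5) = 0"
        "bump (y - 3) = 0" "bump (y - 1) = 0" and "exchange_lift t \<in> \<int>"
      using y H by (auto simp: bump_def)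
    then show ?thesis
      using bump_range[of "y - 5"] by (auto simp: centre_weight_def wt b)
  next
    case 4
    then have "bump (y - 5) = 0" "exchange_lift t \<in> \<int>"
      using x y H by (auto simp: bump_def)
    then show ?thesis
      by (simp add: wt)
  qed
qed

lemma cis_exchange_lift:
  "(if centre_weight (t + 1/2) \<le> centre_weight t
    then cis (2 * pi * (arm_weight 3 t * arm_weight 5 (t + 1/2))) else 1) =
   cis (2 * pi * exchange_lift t)"
proof (cases "centre_weight (t + 1/2) \<le> centre_weight t")
  case True
  then have "cis (2 * pi * (arm_weight 3 t * arm_weight 5 (t + 1/2) - exchange_lift t)) = 1"
    using exchange_lift_mod_1[of t] by (simp add: cis_multiple_2pi)
  then have "cis (2 * pi * (arm_weight 3 t * arm_weight 5 (t + 1/2))) / cis (2 * pi * exchange_lift t) = 1"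
    by (simp only: cis_divide right_diff_distrib)
  then show ?thesis
    using True by simp
next
  case False
  then show ?thesis
    using exchange_lift_mod_1[of t] by (simp add: cis_multiple_2pi)
qed

section \<open>Branches of a tree\<close>

text \<open>For \<open>b\<close> different from \<open>v\<close>, this is the component of
  \<open>b\<close> after removal of the vertex \<open>v\<close>.\<close>

definition branch :: "'a set set \<Rightarrow> 'a \<Rightarrow> 'a \<Rightarrow> 'a set" where
  "branch E v b = {w. (b, w) \<in> {(x, y). {x, y} \<in> E \<and> x \<noteq> v \<and> y \<noteq> v}\<^sup>*}"

lemma fin_graph_edge:
  assumes "fin_graph V E" "{x, y} \<in> E"
  shows "x \<in> V" "y \<in> V" "x \<noteq> y"
proof -
  have "{x, y} \<subseteq> V" "card {x, y} = 2"
    using assms unfolding fin_graph_def by blast+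
  then show "x \<in> V" "y \<in> V" "x \<noteq> y"
    by auto
qed

lemma self_in_branch: "b \<in> branch E v b"
  by (simp add: branch_def)

lemma branch_step:
  assumes "{x, y} \<in> E" "x \<noteq> v" "y \<noteq> v"
  shows "x \<in> branch E v b \<longleftrightarrow> y \<in> branch E v b"
proof -
  have "(x, y) \<in> {(x, y). {x, y} \<in> E \<and> x \<noteq> v \<and> y \<noteq> v}"
    "(y, x) \<in> {(x, y). {x, y} \<in> E \<and> x \<noteq> v \<and> y \<noteq> v}"
    using assms by (auto simp: insert_commute)
  then show ?thesis
    unfolding branch_def by (auto intro: rtrancl_into_rtrancl)
qed

lemma not_in_branch: "b \<noteq> v \<Longrightarrow> v \<notin> branch E v b"
  by (auto simp: branch_def dest: rtranclD tranclD2)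

lemma branch_subset:
  assumes "fin_graph V E" "b \<in> V"
  shows "branch E v b \<subseteq> V"
proof
  fix w assume "w \<in> branch E v b"
  then have "(b, w) \<in> {(x, y). {x, y} \<in> E \<and> x \<noteq> v \<and> y \<noteq> v}\<^sup>*"
    by (simp add: branch_def)
  then show "w \<in> V"
    by induction (use assms in \<open>auto dest: fin_graph_edge\<close>)
qed

lemma graph_path_prefix: "graph_path V E (p @ q) \<Longrightarrow> p \<noteq> [] \<Longrightarrow> graph_path V E p"
  by (auto simp: graph_path_def successively_append_iff)

lemma graph_path_snoc:
  assumes "graph_path V E p" "{last p, w} \<in> E" "w \<in> V" "w \<notin> set p"
  shows "graph_path V E (p @ [w])"
  using assms by (auto simp: graph_path_def successively_append_iff)

lemma graph_path_Cons:
  assumes "graph_path V E p" "{w, hd p} \<in> E" "w \<in> V" "w \<notin> set p"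
  shows "graph_path V E (w # p)"
  using assms by (cases p) (auto simp: graph_path_def)

lemma branch_path:
  assumes "fin_graph V E" "b \<in> V" "b \<noteq> v" "w \<in> branch E v b"
  shows "\<exists>p. graph_path V E p \<and> hd p = b \<and> last p = w \<and> v \<notin> set p"
proof -
  from assms(4) have "(b, w) \<in> {(x, y). {x, y} \<in> E \<and> x \<noteq> v \<and> y \<noteq> v}\<^sup>*"
    by (simp add: branch_def)
  then show ?thesis
  proof induction
    case base
    show ?case
      by (rule exI[of _ "[b]"]) (use assms in \<open>auto simp: graph_path_def\<close>)
  next
    case (step y z)
    then obtain p where p: "graph_path V E p" "hd p = b" "last p = y" "v \<notin> set p"
      by blast
    have yz: "{y, z} \<in> E" "z \<noteq> v" "z \<in> V"
      using step fin_graph_edge[OF assms(1)] by auto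
    show ?case
    proof (cases "z \<in> set p")
      case True
      then obtain p1 p2 where eq: "p = p1 @ z # p2"
        by (meson split_list)
      have "graph_path V E ((p1 @ [z]) @ p2)"
        using p eq by simp
      then have "graph_path V E (p1 @ [z])"
        by (rule graph_path_prefix) simp
      moreover have "hd (p1 @ [z]) = b"
        using p eq by (cases p1) auto
      ultimately show ?thesis
        using p eq by (intro exI[of _ "p1 @ [z]"]) auto
    next
      case False
      have "graph_path V E (p @ [z])"
        using graph_path_snoc[OF p(1)] p yz False by simp
      moreover have "p \<noteq> []"
        using p by (simp add: graph_path_def)
      ultimately show ?thesis
        using p yz by (intro exI[of _ "p @ [z]"]) auto
    qed
  qed
qed

text \<open>Otherwise a path from \<open>b\<close> to \<open>b'\<close> that avoids \<open>v\<close>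
  closes up to a cycle through \<open>v\<close>.\<close>

lemma branch_disjoint:
  assumes T: "fin_tree V E" and b: "{v, b} \<in> E" "{v, b'} \<in> E" "b \<noteq> b'"
  shows "branch E v b \<inter> branch E v b' = {}"
proof (rule ccontr)
  let ?R = "{(x, y). {x, y} \<in> E \<and> x \<noteq> v \<and> y \<noteq> v}"
  have G: "fin_graph V E"
    using T by (simp add: fin_tree_def)
  assume "branch E v b \<inter> branch E v b' \<noteq> {}"
  then obtain w where "(b, w) \<in> ?R\<^sup>*" "(b', w) \<in> ?R\<^sup>*"
    by (auto simp: branch_def)
  moreover have "sym ?R"
    by (auto simp: sym_def insert_commute)
  then have "sym (?R\<^sup>*)"
    by (rule sym_rtrancl)
  ultimately have "(b, b') \<in> ?R\<^sup>*"
    by (meson rtrancl_trans symD)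
  then have "b' \<in> branch E v b"
    by (simp add: branch_def)
  then obtain p where p: "graph_path V E p" "hd p = b" "last p = b'" "v \<notin> set p"
    using branch_path[OF G] fin_graph_edge[OF G b(1)] by metis
  have "graph_path V E (v # p)"
    using graph_path_Cons[OF p(1)] p b fin_graph_edge[OF G b(1)] by auto
  moreover have "3 \<le> length (v # p)"
  proof -
    obtain x q where "p = x # q"
      using p by (cases p) (auto simp: graph_path_def)
    then show ?thesis
      using p b by (cases q) auto
  qed
  moreover have "p \<noteq> []"
    using p by (simp add: graph_path_def)
  ultimately have "graph_cycle V E (v # p)"
    using p b by (simp add: graph_cycle_def insert_commute)
  then show False
    using T by (auto simp: fin_tree_def)
qed

section \<open>Neighbours, leaves and subdivision\<close>

lemma vertex_degree_eq_card_neighbours: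
  assumes "fin_graph V E"
  shows "vertex_degree E v = card {w. {v, w} \<in> E}" "finite {w. {v, w} \<in> E}"
proof -
  have "bij_betw (\<lambda>w. {v, w}) {w. {v, w} \<in> E} {e \<in> E. v \<in> e}"
    unfolding bij_betw_def
  proof (intro conjI equalityI subsetI)
    show "inj_on (\<lambda>w. {v, w}) {w. {v, w} \<in> E}"
      by (auto simp: inj_on_def doubleton_eq_iff)
    fix e assume e: "e \<in> {e \<in> E. v \<in> e}"
    then have "card e = 2"
      using assms by (auto simp: fin_graph_def)
    then obtain x y where "e = {x, y}"
      by (auto simp: card_2_iff)
    then obtain w where "e = {v, w}"
      using e by auto
    then show "e \<in> (\<lambda>w. {v, w}) ` {w. {v, w} \<in> E}"
      using e by auto
  qed auto
  then show "vertex_degree E v = card {w. {v, w} \<in> E}"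
    unfolding vertex_degree_def by (rule bij_betw_same_card[symmetric])
  show "finite {w. {v, w} \<in> E}"
  proof (rule finite_subset)
    show "{w. {v, w} \<in> E} \<subseteq> V"
      using fin_graph_edge(2)[OF assms] by blast
    show "finite V"
      using assms by (simp add: fin_graph_def)
  qed
qed

text \<open>At the end of a longest path a further neighbour would prolong the path or close a
  cycle. For odd n the surplus particle rests at such a vertex.\<close>

lemma ex_vertex_degree_le_1:
  assumes T: "fin_tree V E"
  shows "\<exists>x\<in>V. vertex_degree E x \<le> 1"
proof -
  have G: "fin_graph V E" and "V \<noteq> {}"
    using T by (auto simp: fin_tree_def graph_connected_def)
  then obtain x0 where "x0 \<in> V" by blast
  then have "graph_path V E [x0]"
    by (simp add: graph_path_def)
  moreover have "length p < Suc (card V)" if "graph_path V E p" for p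
    using that G card_mono[of V "set p"] distinct_card[of p]
    by (auto simp: graph_path_def fin_graph_def)
  ultimately obtain p where p: "graph_path V E p"
    and max: "\<And>p'. graph_path V E p' \<Longrightarrow> length p' \<le> length p"
    using ex_has_greatest_nat[of "graph_path V E" "[x0]" length "Suc (card V)"]
    by (metis less_imp_le)
  obtain x q where pq: "p = x # q"
    using p by (cases p) (auto simp: graph_path_def)
  have "w = hd q" if w: "{x, w} \<in> E" for w
  proof -
    have xw: "w \<in> V" "x \<noteq> w"
      using fin_graph_edge[OF G w] by auto
    have "w \<in> set p"
    proof (rule ccontr)
      assume "w \<notin> set p"
      then have "graph_path V E (w # p)"
        using graph_path_Cons[OF p] w pq xw by (simp add: insert_commute)
      from max[OF this] show False by simp
    qed
    then obtain q1 q2 where q: "q = q1 @ w # q2"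
      using xw pq by (auto dest: split_list)
    show ?thesis
    proof (cases q1)
      case (Cons y q1')
      have "graph_path V E ((x # q1 @ [w]) @ q2)"
        using p pq q by simp
      then have "graph_path V E (x # q1 @ [w])"
        by (rule graph_path_prefix) simp
      then have "graph_cycle V E (x # q1 @ [w])"
        using w Cons by (simp add: graph_cycle_def insert_commute)
      then show ?thesis
        using T by (auto simp: fin_tree_def)
    qed (use q in simp)
  qed
  then have "{w. {x, w} \<in> E} \<subseteq> {hd q}"
    by blast
  then have "card {w. {x, w} \<in> E} \<le> card {hd q}"
    by (intro card_mono) auto
  then have "vertex_degree E x \<le> 1"
    by (simp add: vertex_degree_eq_card_neighbours[OF G])
  moreover have "x \<in> V"
    using p pq by (simp add: graph_path_def)
  ultimately show ?thesis by blast
qed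

text \<open>Used backwards: for n at least 3 the resting vertex is off every chosen star. Together
  with the next lemma, for n at least 4, distinct chosen stars are disjoint.\<close>

lemma sufficiently_subdivided_adjacent:
  assumes "fin_graph V E" "sufficiently_subdivided V E n"
    and "{u, w} \<in> E" "vertex_degree E u \<noteq> 2" "vertex_degree E w \<noteq> 2"
  shows "n \<le> 2"
proof -
  have "graph_path V E [u, w]"
    using fin_graph_edge[OF assms(1,3)] assms(3) by (auto simp: graph_path_def)
  then have "n - 1 \<le> length [u, w] - 1"
    using assms fin_graph_edge[OF assms(1,3)] unfolding sufficiently_subdivided_def
    by (metis last.simps list.sel(1) list.discI)
  then show ?thesis by simp
qed

lemma sufficiently_subdivided_common_neighbour:
  assumes "fin_graph V E" "sufficiently_subdivided V E n" "u \<noteq> w"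
    and "{u, x} \<in> E" "{w, x} \<in> E" "vertex_degree E u \<noteq> 2" "vertex_degree E w \<noteq> 2"
  shows "n \<le> 3"
proof -
  have "graph_path V E [u, x, w]"
    using fin_graph_edge[OF assms(1,4)] fin_graph_edge[OF assms(1,5)] assms(3-5)
    by (auto simp: graph_path_def insert_commute)
  then have "n - 1 \<le> length [u, x, w] - 1"
    using assms unfolding sufficiently_subdivided_def
    by (metis last.simps list.sel(1) list.discI)
  then show ?thesis by simp
qed

lemma obtain_three_neighbours:
  assumes "fin_graph V E" "3 \<le> vertex_degree E v"
  obtains a b c where "{v, a} \<in> E" "{v, b} \<in> E" "{v, c} \<in> E" "a \<noteq> b" "a \<noteq> c" "b \<noteq> c"
proof -
  obtain S where "S \<subseteq> {w. {v, w} \<in> E}" "card S = 3"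
    using assms vertex_degree_eq_card_neighbours[OF assms(1)] by (metis obtain_subset_with_card_n)
  then show thesis
    using that by (auto simp: card_3_iff)
qed

text \<open>\<open>b\<close> and \<open>b'\<close> are the arms in which the tripods
  \<open>a, b, c\<close> and \<open>a, b', c\<close> at the same vertex will differ.\<close>

lemma obtain_four_neighbours:
  assumes "fin_graph V E" "4 \<le> vertex_degree E v"
  obtains a b b' c where "{v, a} \<in> E" "{v, b} \<in> E" "{v, b'} \<in> E" "{v, c} \<in> E"
    "a \<noteq> b" "a \<noteq> b'" "a \<noteq> c" "b \<noteq> c" "b' \<noteq> c" "b \<noteq> b'"
proof -
  obtain S where S: "S \<subseteq> {w. {v, w} \<in> E}" "card S = 4"
    using assms vertex_degree_eq_card_neighbours[OF assms(1)] by (metis obtain_subset_with_card_n)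
  then obtain x S' where "S = insert x S'" "x \<notin> S'" "card S' = 3"
    using card_Suc_eq[of S 3] by auto
  then show thesis
    using that[of x] S(1) by (auto simp: card_3_iff)
qed

section \<open>Circle-valued functions on configuration spaces\<close>

definition branch_weight :: "'a set set \<Rightarrow> 'a \<Rightarrow> 'a \<Rightarrow> ('a \<Rightarrow> real) \<Rightarrow> real" where
  "branch_weight E v b y = (\<Sum>w\<in>branch E v b. y w)"

definition pair_phase :: "'a set set \<Rightarrow> 'a \<Rightarrow> 'a \<Rightarrow> 'a \<Rightarrow> ('a \<Rightarrow> real) \<Rightarrow> ('a \<Rightarrow> real) \<Rightarrow> complex" where
  "pair_phase E v a b x y =
     (if y v \<le> x v then cis (2 * pi * (branch_weight E v a x * branch_weight E v b y)) else 1)"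

text \<open>
  Two particles on disjoint closed cells never both have positive weight at \<open>v\<close>, so the
  first alternative in \<^const>\<open>pair_phase\<close> records how far \<open>x\<close> has advanced into the edge
  from \<open>v\<close> to \<open>a\<close> while \<open>y\<close> sits in the branch of \<open>b\<close>.  The resulting circle-valued function
  represents the class of the cellular cocycle that assigns to an edge of the configuration space
  moving a particle along \<open>{v, a}\<close> the number of particles in the branch of \<open>b\<close>.
\<close>

definition phase :: "'a set set \<Rightarrow> nat \<Rightarrow> 'a \<Rightarrow> 'a \<Rightarrow> 'a \<Rightarrow> (nat \<Rightarrow> 'a \<Rightarrow> real) \<Rightarrow> complex" where
  "phase E n v a b x = (\<Prod>p<n. \<Prod>q\<in>{..<n} - {p}. pair_phase E v a b (x p) (x q))"

abbreviation simplices :: "'a set \<Rightarrow> 'a set set \<Rightarrow> 'a set set" where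
  "simplices V E \<equiv> (\<lambda>v. {v}) ` V \<union> E"

text \<open>Apart from \<open>v\<close>, a cell does not meet two branches: an edge that avoids
  \<open>v\<close> stays in its branch, and an edge at \<open>v\<close> has one other end.\<close>

lemma branch_weight_integral:
  assumes G: "fin_graph V E" and b: "b \<in> V" "b \<noteq> v"
    and \<sigma>: "\<sigma> \<in> simplices V E" and y: "y \<in> closed_cell V \<sigma>" "y v = 0"
  shows "branch_weight E v b y \<in> {0, 1}"
proof -
  have fin: "finite V" and bV: "branch E v b \<subseteq> V"
    using G branch_subset[OF G b(1)] by (auto simp: fin_graph_def)
  have supp: "y w = 0" if "w \<in> V" "w \<notin> \<sigma> - {v}" for w
    using y that by (cases "w = v") (auto simp: closed_cell_def)
  have "\<sigma> - {v} \<subseteq> branch E v b \<or> (\<sigma> - {v}) \<inter> branch E v b = {}"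
  proof (cases "\<exists>x z. \<sigma> = {x, z} \<and> \<sigma> \<in> E \<and> x \<noteq> v \<and> z \<noteq> v")
    case True
    then obtain x z where "\<sigma> = {x, z}" "{x, z} \<in> E" "x \<noteq> v" "z \<noteq> v"
      by blast
    then show ?thesis
      using branch_step[of x z E v b] by auto
  next
    case False
    have "\<exists>w. \<sigma> - {v} \<subseteq> {w}"
    proof (cases "\<sigma> \<in> E")
      case True
      then have "card \<sigma> = 2"
        using G by (simp add: fin_graph_def)
      then obtain x z where "\<sigma> = {x, z}"
        by (auto simp: card_2_iff)
      then show ?thesis
        using False True by auto
    qed (use \<sigma> in auto)
    then show ?thesis by blast
  qed
  then show ?thesis
  proof
    assume "\<sigma> - {v} \<subseteq> branch E v b"
    then have "branch_weight E v b y = (\<Sum>w\<in>V. y w)"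
      unfolding branch_weight_def using supp bV fin by (intro sum.mono_neutral_left) auto
    then show ?thesis
      using y by (simp add: closed_cell_def)
  next
    assume "(\<sigma> - {v}) \<inter> branch E v b = {}"
    then have "branch_weight E v b y = 0"
      unfolding branch_weight_def using supp bV by (intro sum.neutral) blast
    then show ?thesis by simp
  qed
qed

text \<open>If \<open>y\<close> has weight at \<open>v\<close>, the second alternative applies.
  Otherwise both branch weights are 0 or 1 and the angle is a whole number of turns.\<close>

lemma pair_phase_eq_1:
  assumes G: "fin_graph V E" and v: "v \<in> V" and ab: "a \<in> V" "a \<noteq> v" "b \<in> V" "b \<noteq> v"
    and \<sigma>: "\<sigma> \<in> simplices V E" "x \<in> closed_cell V \<sigma>" and \<tau>: "\<tau> \<in> simplices V E" "y \<in> closed_cell V \<tau>"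
    and x: "x v = 0"
  shows "pair_phase E v a b x y = 1"
proof (cases "y v \<le> x v")
  case True
  then have "y v = 0"
    using \<tau>(2) x v by (auto simp: closed_cell_def intro: antisym)
  then have "branch_weight E v a x * branch_weight E v b y \<in> \<int>"
    using branch_weight_integral[OF G ab(1,2) \<sigma> x] branch_weight_integral[OF G ab(3,4) \<tau>] by auto
  then show ?thesis
    by (simp add: pair_phase_def cis_multiple_2pi)
qed (simp add: pair_phase_def)

section \<open>From pairs of points to configurations\<close>

lemma topspace_realization: "topspace (realization V E) = \<Union>(closed_cells V E)"
proof -
  have "\<Union>(closed_cells V E) \<subseteq> extensional V"
    by (auto simp: closed_cells_def closed_cell_def)
  then show ?thesis
    by (auto simp: realization_def PiE_def)
qed

lemma topspace_discrete_conf: "topspace (discrete_conf V E n) = discrete_conf_set V E n"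
proof -
  have "discrete_conf_set V E n \<subseteq> topspace (power_space n (realization V E))"
    by (auto simp: discrete_conf_set_def configurations_def)
  then show ?thesis
    by (auto simp: discrete_conf_def)
qed

lemma discrete_conf_cells:
  assumes x: "x \<in> discrete_conf_set V E n"
  obtains \<sigma> where "\<And>p. p < n \<Longrightarrow> \<sigma> p \<in> simplices V E" "\<And>p. p < n \<Longrightarrow> x p \<in> closed_cell V (\<sigma> p)"
    "\<And>p q. p < n \<Longrightarrow> q < n \<Longrightarrow> p \<noteq> q \<Longrightarrow> closed_cell V (\<sigma> p) \<inter> closed_cell V (\<sigma> q) = {}"
proof -
  obtain c where c: "x \<in> (\<Pi>\<^sub>E i\<in>{..<n}. c i)" "\<forall>i<n. c i \<in> closed_cells V E"
      "disjoint_family_on c {..<n}"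
    using x unfolding discrete_conf_set_eq by blast
  have "\<exists>\<sigma>. p < n \<longrightarrow> \<sigma> \<in> simplices V E \<and> c p = closed_cell V \<sigma>" for p
  proof (cases "p < n")
    case True
    then have "c p \<in> closed_cell V ` simplices V E"
      using c(2) by (simp add: closed_cells_def)
    then show ?thesis by blast
  qed simp
  then obtain \<sigma> where "\<And>p. p < n \<Longrightarrow> \<sigma> p \<in> simplices V E \<and> c p = closed_cell V (\<sigma> p)"
    by metis
  then show thesis
    using c by (intro that[of \<sigma>]) (auto simp: disjoint_family_on_def PiE_iff)
qed

lemma discrete_conf_not_both_at:
  assumes G: "fin_graph V E" and x: "x \<in> discrete_conf_set V E n" and v: "v \<in> V"
    and pq: "p < n" "q < n" "p \<noteq> q"
  shows "x p v = 0 \<or> x q v = 0"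
proof (rule ccontr)
  assume ne: "\<not> (x p v = 0 \<or> x q v = 0)"
  obtain \<sigma> where \<sigma>: "\<And>p. p < n \<Longrightarrow> x p \<in> closed_cell V (\<sigma> p)"
    "\<And>p q. p < n \<Longrightarrow> q < n \<Longrightarrow> p \<noteq> q \<Longrightarrow> closed_cell V (\<sigma> p) \<inter> closed_cell V (\<sigma> q) = {}"
    using discrete_conf_cells[OF x] by metis
  have "v \<in> \<sigma> p" "v \<in> \<sigma> q"
    using \<sigma>(1)[OF pq(1)] \<sigma>(1)[OF pq(2)] ne v by (auto simp: closed_cell_def)
  moreover have "finite V"
    using G by (simp add: fin_graph_def)
  ultimately have "(\<lambda>w\<in>V. if w = v then 1 else 0) \<in> closed_cell V (\<sigma> p) \<inter> closed_cell V (\<sigma> q)"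
    using v by (auto simp: closed_cell_def)
  then show False
    using \<sigma>(2)[OF pq] by blast
qed

lemma continuous_map_conf_weight:
  assumes "p < n" "w \<in> V"
  shows "continuous_map (discrete_conf V E n) euclideanreal (\<lambda>x. x p w)"
proof -
  have "continuous_map (power_space n (realization V E)) (realization V E) (\<lambda>x. x p)"
    unfolding power_space_def by (rule continuous_map_product_projection) (use assms in simp)
  moreover have "continuous_map (realization V E) euclideanreal (\<lambda>y. y w)"
    unfolding realization_def
    by (intro continuous_map_from_subtopology continuous_map_product_projection) (use assms in simp)
  ultimately have "continuous_map (power_space n (realization V E)) euclideanreal ((\<lambda>y. y w) \<circ> (\<lambda>x. x p))"
    by (rule continuous_map_compose)
  then show ?thesis
    unfolding discrete_conf_def by (intro continuous_map_from_subtopology) (simp add: o_def)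
qed

lemma continuous_map_cis:
  assumes "continuous_map X euclideanreal f"
  shows "continuous_map X euclidean (\<lambda>x. cis (f x))"
proof -
  have "continuous_map euclideanreal euclidean cis"
    by (simp add: continuous_intros)
  from continuous_map_compose[OF assms this] show ?thesis
    by (simp add: o_def)
qed

text \<open>The two alternatives meet where the weights at \<open>v\<close> are equal. Disjoint
  cells force both weights to be 0 there, and then the first formula gives 1 as well.\<close>

lemma continuous_map_pair_phase:
  assumes G: "fin_graph V E" and v: "v \<in> V" and ab: "a \<in> V" "a \<noteq> v" "b \<in> V" "b \<noteq> v"
    and pq: "p < n" "q < n" "p \<noteq> q"
  shows "continuous_map (discrete_conf V E n) euclidean (\<lambda>x. pair_phase E v a b (x p) (x q))"
  unfolding pair_phase_def
proof (rule continuous_map_cases_le)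
  have "finite V"
    using G by (simp add: fin_graph_def)
  then have "finite (branch E v c)" if "c \<in> V" for c
    by (rule finite_subset[OF branch_subset[OF G that]])
  moreover have "branch E v a \<subseteq> V" "branch E v b \<subseteq> V"
    using branch_subset[OF G] ab by blast+
  ultimately have "continuous_map (discrete_conf V E n) euclidean
      (\<lambda>x. cis (2 * pi * (branch_weight E v a (x p) * branch_weight E v b (x q))))"
    unfolding branch_weight_def using ab pq
    by (intro continuous_map_cis continuous_map_real_mult_left continuous_map_real_mult
        continuous_map_sum continuous_map_conf_weight) auto
  then show "continuous_map (subtopology (discrete_conf V E n)
      {x \<in> topspace (discrete_conf V E n). x q v \<le> x p v}) euclidean
      (\<lambda>x. cis (2 * pi * (branch_weight E v a (x p) * branch_weight E v b (x q))))"
    by (rule continuous_map_from_subtopology)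
next
  fix x assume x: "x \<in> topspace (discrete_conf V E n)" "x q v = x p v"
  then have xD: "x \<in> discrete_conf_set V E n"
    by (simp add: topspace_discrete_conf)
  then obtain \<sigma> where \<sigma>: "\<And>p. p < n \<Longrightarrow> \<sigma> p \<in> simplices V E" "\<And>p. p < n \<Longrightarrow> x p \<in> closed_cell V (\<sigma> p)"
    using discrete_conf_cells by metis
  have "x p v = 0"
    using discrete_conf_not_both_at[OF G xD v pq] x by auto
  from pair_phase_eq_1[OF G v ab \<sigma>(1)[OF pq(1)] \<sigma>(2)[OF pq(1)] \<sigma>(1)[OF pq(2)] \<sigma>(2)[OF pq(2)] this]
  show "cis (2 * pi * (branch_weight E v a (x p) * branch_weight E v b (x q))) = 1"
    using x by (simp add: pair_phase_def)
qed (use v pq in \<open>auto intro: continuous_map_conf_weight\<close>)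

lemma continuous_map_prod_complex:
  fixes f :: "'b \<Rightarrow> 'i \<Rightarrow> complex"
  assumes "\<And>i. i \<in> I \<Longrightarrow> continuous_map X euclidean (\<lambda>x. f x i)"
  shows "continuous_map X euclidean (\<lambda>x. prod (f x) I)"
  using assms by (simp add: continuous_map_atin tendsto_prod)

lemma continuous_map_phase:
  assumes "fin_graph V E" "v \<in> V" "a \<in> V" "a \<noteq> v" "b \<in> V" "b \<noteq> v"
  shows "continuous_map (discrete_conf V E n) euclidean (phase E n v a b)"
  unfolding phase_def[abs_def]
  by (intro continuous_map_prod_complex continuous_map_pair_phase) (use assms in auto)

lemma phase_permute:
  assumes "\<pi> permutes {..<n}"
  shows "phase E n v a b (x \<circ> \<pi>) = phase E n v a b x"
proof -
  let ?f = "\<lambda>p q. pair_phase E v a b (x p) (x q)"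
  have inner: "(\<Prod>q\<in>{..<n} - {p}. ?f (\<pi> p) (\<pi> q)) = (\<Prod>q\<in>{..<n} - {\<pi> p}. ?f (\<pi> p) q)" if "p < n" for p
  proof (rule prod.reindex_bij_betw)
    have "bij_betw \<pi> ({..<n} - {p}) (\<pi> ` ({..<n} - {p}))"
      using permutes_inj[OF assms] by (auto simp: bij_betw_def intro: inj_on_subset)
    also have "\<pi> ` ({..<n} - {p}) = {..<n} - {\<pi> p}"
      using permutes_inj[OF assms] permutes_image[OF assms] by (simp add: image_set_diff)
    finally show "bij_betw \<pi> ({..<n} - {p}) ({..<n} - {\<pi> p})" .
  qed
  have "phase E n v a b (x \<circ> \<pi>) = (\<Prod>p<n. (\<lambda>p. \<Prod>q\<in>{..<n} - {p}. ?f p q) (\<pi> p))"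
    unfolding phase_def o_def by (rule prod.cong[OF refl]) (rule inner, simp)
  also have "\<dots> = phase E n v a b x"
    unfolding phase_def by (rule prod.permute[OF assms, unfolded o_def, symmetric])
  finally show ?thesis .
qed

lemma norm_phase: "norm (phase E n v a b x) = 1"
proof -
  have "norm (pair_phase E v a b y z) = 1" for y z
    by (simp add: pair_phase_def)
  then show ?thesis
    by (simp add: phase_def flip: prod_norm)
qed

lemma unordered_phase:
  assumes "fin_graph V E" "v \<in> V" "a \<in> V" "a \<noteq> v" "b \<in> V" "b \<noteq> v"
  obtains f where "continuous_map (unordered_discrete_conf V E n) euclidean f"
    "\<And>x. x \<in> discrete_conf_set V E n \<Longrightarrow> f (perm_orbit n x) = phase E n v a b x"
    "\<And>y. y \<in> topspace (unordered_discrete_conf V E n) \<Longrightarrow> f y \<noteq> 0"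
proof -
  let ?D = "discrete_conf V E n"
  obtain f where f: "continuous_map (unordered_discrete_conf V E n) euclidean f"
    "f ` topspace (unordered_discrete_conf V E n) = phase E n v a b ` topspace ?D"
    "\<And>x. x \<in> topspace ?D \<Longrightarrow> f (perm_orbit n x) = phase E n v a b x"
  proof (rule quotient_map_lift_exists[OF _ continuous_map_phase[OF assms]])
    show "quotient_map ?D (unordered_discrete_conf V E n) (perm_orbit n)"
      unfolding unordered_discrete_conf_def by (rule quotient_map_quotient_topology)
    fix x y :: "nat \<Rightarrow> 'a \<Rightarrow> real" assume "perm_orbit n x = perm_orbit n y"
    moreover have "x \<in> perm_orbit n x"
      unfolding perm_orbit_def using permutes_id[of "{..<n}"] by (metis (mono_tags, lifting) comp_id mem_Collect_eq)
    ultimately have "x \<in> perm_orbit n y"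
      by simp
    then obtain \<pi> where "\<pi> permutes {..<n}" "x = y \<circ> \<pi>"
      by (auto simp: perm_orbit_def)
    then show "phase E n v a b x = phase E n v a b y"
      by (simp add: phase_permute)
  qed (rule that)
  have "f y \<noteq> 0" if "y \<in> topspace (unordered_discrete_conf V E n)" for y
  proof -
    have "f y \<in> phase E n v a b ` topspace ?D"
      using f(2) that by blast
    then obtain x where "f y = phase E n v a b x"
      by blast
    then show ?thesis
      using norm_phase[of E n v a b x] by auto
  qed
  then show thesis
    using f that by (simp add: topspace_discrete_conf)
qed

section \<open>Tori of exchanging pairs\<close>

text \<open>The arms are visited in the order \<open>c\<close>, \<open>a\<close>, \<open>b\<close>,
  so a particle that enters \<open>a\<close> has its partner, half a period away, at rest at
  \<open>b\<close>.\<close>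

definition star_point :: "'a set \<Rightarrow> 'a \<Rightarrow> 'a \<Rightarrow> 'a \<Rightarrow> 'a \<Rightarrow> real \<Rightarrow> 'a \<Rightarrow> real" where
  "star_point V v a b c t = (\<lambda>w\<in>V. (if w = a then arm_weight 3 t else 0) + (if w = b then arm_weight 5 t else 0) +
     (if w = c then arm_weight 1 t else 0) + (if w = v then centre_weight t else 0))"

definition vertex_point :: "'a set \<Rightarrow> 'a \<Rightarrow> 'a \<Rightarrow> real" where
  "vertex_point V x = (\<lambda>w\<in>V. if w = x then 1 else 0)"

lemma sum_star_point:
  assumes "finite V" "S \<subseteq> V"
  shows "(\<Sum>w\<in>S. star_point V v a b c t w) =
    (if a \<in> S then arm_weight 3 t else 0) + (if b \<in> S then arm_weight 5 t else 0) +
    (if c \<in> S then arm_weight 1 t else 0) + (if v \<in> S then centre_weight t else 0)"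
proof -
  have "finite S"
    using assms finite_subset by blast
  have "(\<Sum>w\<in>S. star_point V v a b c t w) =
      (\<Sum>w\<in>S. (if w = a then arm_weight 3 t else 0) + (if w = b then arm_weight 5 t else 0) +
     (if w = c then arm_weight 1 t else 0) + (if w = v then centre_weight t else 0))"
    using assms(2) by (intro sum.cong) (auto simp: star_point_def)
  then show ?thesis
    by (simp only: sum.distrib sum.delta[OF \<open>finite S\<close>])
qed

lemma sum_vertex_point:
  assumes "finite V" "S \<subseteq> V"
  shows "(\<Sum>w\<in>S. vertex_point V x w) = (if x \<in> S then 1 else 0)"
proof -
  have "finite S"
    using assms finite_subset by blast
  have "(\<Sum>w\<in>S. vertex_point V x w) = (\<Sum>w\<in>S. if w = x then 1 else 0)"
    using assms(2) by (intro sum.cong) (auto simp: vertex_point_def)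
  then show ?thesis
    using \<open>finite S\<close> by simp
qed

lemma vertex_point_in_cell: "finite V \<Longrightarrow> x \<in> V \<Longrightarrow> vertex_point V x \<in> closed_cell V {x}"
  using sum_vertex_point[of V V x] by (auto simp: closed_cell_def vertex_point_def)

lemma star_point_add_Ints: "z \<in> \<int> \<Longrightarrow> star_point V v a b c (t + z) = star_point V v a b c t"
  by (simp add: star_point_def centre_weight_def arm_weight_add_Ints cong: if_cong)

lemma disjoint_cells:
  assumes "\<sigma> \<inter> \<tau> = {}"
  shows "closed_cell V \<sigma> \<inter> closed_cell V \<tau> = {}"
proof (rule ccontr)
  assume "closed_cell V \<sigma> \<inter> closed_cell V \<tau> \<noteq> {}"
  then obtain y where y: "y \<in> closed_cell V \<sigma>" "y \<in> closed_cell V \<tau>"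
    by blast
  then have "y w = 0" if "w \<in> V" for w
    using that assms by (auto simp: closed_cell_def)
  then have "(\<Sum>w\<in>V. y w) = 0"
    by simp
  then show False
    using y by (simp add: closed_cell_def)
qed

section \<open>Two particles on one tripod\<close>

locale tripod =
  fixes V :: "'a set" and E :: "'a set set" and v a b c :: 'a
  assumes tree: "fin_tree V E"
    and edges: "{v, a} \<in> E" "{v, b} \<in> E" "{v, c} \<in> E"
    and distinct_arms: "a \<noteq> b" "a \<noteq> c" "b \<noteq> c"
begin

lemma graph: "fin_graph V E"
  using tree by (simp add: fin_tree_def)

lemma finite_V: "finite V"
  using graph by (simp add: fin_graph_def)

lemma in_V: "v \<in> V" "a \<in> V" "b \<in> V" "c \<in> V"
  and arms_ne: "a \<noteq> v" "b \<noteq> v" "c \<noteq> v"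
  using edges[THEN fin_graph_edge(1)[OF graph]] edges[THEN fin_graph_edge(2)[OF graph]]
    edges[THEN fin_graph_edge(3)[OF graph]] by auto

abbreviation point :: "real \<Rightarrow> 'a \<Rightarrow> real" where
  "point \<equiv> star_point V v a b c"

definition arm_end :: "real \<Rightarrow> 'a" where
  "arm_end k = (if k = 3 then a else if k = 5 then b else c)"

lemma sum_point: "(\<Sum>w\<in>V. point t w) = 1"
  using sum_star_point[OF finite_V order_refl, of v a b c t] in_V by (simp add: centre_weight_def)

lemma point_nonneg: "w \<in> V \<Longrightarrow> 0 \<le> point t w"
  by (simp add: star_point_def arm_weight_range centre_weight_nonneg)

lemma point_in_cell:
  assumes "\<And>w. w \<in> V \<Longrightarrow> w \<notin> \<sigma> \<Longrightarrow> point t w = 0"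
  shows "point t \<in> closed_cell V \<sigma>"
proof -
  have "point t \<in> extensional V"
    by (simp add: star_point_def)
  then show ?thesis
    using assms sum_point[of t] point_nonneg by (simp add: closed_cell_def)
qed

lemma point_arm_end: "l \<in> {1, 3, 5} \<Longrightarrow> point t (arm_end l) = arm_weight l t"
  using distinct_arms arms_ne in_V by (auto simp: star_point_def arm_end_def)

lemma point_off_star: "w \<in> V \<Longrightarrow> w \<notin> {v, a, b, c} \<Longrightarrow> point t w = 0"
  by (simp add: star_point_def)

lemma point_centre: "point t v = centre_weight t"
  using arms_ne in_V by (simp add: star_point_def)

lemma point_eq_0:
  assumes "w \<in> V" "w \<noteq> v" "\<And>l. l \<in> {1, 3, 5} \<Longrightarrow> w = arm_end l \<Longrightarrow> arm_weight l t = 0"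
  shows "point t w = 0"
proof (cases "w \<in> {a, b, c}")
  case True
  then have "w = arm_end 1 \<or> w = arm_end 3 \<or> w = arm_end 5"
    by (auto simp: arm_end_def)
  then show ?thesis
    using assms(3)[of 1] assms(3)[of 3] assms(3)[of 5] point_arm_end[of 1 t] point_arm_end[of 3 t]
      point_arm_end[of 5 t] by (elim disjE) simp_all
qed (use assms point_off_star in simp)

lemma point_resting:
  assumes k: "k \<in> {1, 3, 5}" "arm_weight k t = 1"
  shows "point t \<in> closed_cell V {arm_end k}"
proof (rule point_in_cell)
  fix w assume w: "w \<in> V" "w \<notin> {arm_end k}"
  have zero: "arm_weight l t = 0" if "l \<in> {1, 3, 5}" "l \<noteq> k" for l
    using arm_weight_disjoint[OF that(1) k(1) that(2), of t] k(2) by simp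
  show "point t w = 0"
  proof (cases "w = v")
    case True
    have "k = 1 \<or> k = 3 \<or> k = 5"
      using k by simp
    then have "centre_weight t = 0"
      using k(2) zero[of 1] zero[of 3] zero[of 5] by (elim disjE) (simp_all add: centre_weight_def)
    with True show ?thesis
      by (simp add: point_centre)
  next
    case False
    show ?thesis
      by (rule point_eq_0[OF w(1) False]) (use w zero in blast)
  qed
qed

text \<open>At most one arm weight is nonzero, and the point lies on the edge to that arm. At the
  centre itself every edge would do; the one taken avoids arm \<open>k\<close>, where the other
  particle rests.\<close>

lemma point_moving:
  assumes k: "k \<in> {1, 3, 5}" "arm_weight k t = 0"
  shows "\<exists>k'\<in>{1, 3, 5} - {k}. point t \<in> closed_cell V {v, arm_end k'}"
proof -
  have "\<exists>k'\<in>{1, 3, 5} - {k}. \<forall>l\<in>{1, 3, 5}. l \<noteq> k' \<longrightarrow> arm_weight l t = 0"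
  proof (cases "\<exists>m\<in>{1, 3, 5}. arm_weight m t \<noteq> 0")
    case True
    then obtain m where m: "m \<in> {1, 3, 5}" "arm_weight m t \<noteq> 0"
      by blast
    moreover have "arm_weight l t = 0" if "l \<in> {1, 3, 5}" "l \<noteq> m" for l
      using arm_weight_disjoint[OF that(1) m(1) that(2), of t] m(2) by simp
    ultimately show ?thesis
      using k by (intro bexI[of _ m]) auto
  next
    case False
    have "(if k = 1 then 3 else 1) \<in> {1, 3, 5} - {k}"
      by simp
    then show ?thesis
      by (rule bexI[rotated]) (use False in blast)
  qed
  then obtain k' where k': "k' \<in> {1, 3, 5} - {k}" "\<forall>l\<in>{1, 3, 5}. l \<noteq> k' \<longrightarrow> arm_weight l t = 0"
    by (rule bexE)
  have "point t \<in> closed_cell V {v, arm_end k'}"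
  proof (rule point_in_cell)
    fix w assume w: "w \<in> V" "w \<notin> {v, arm_end k'}"
    show "point t w = 0"
    proof (rule point_eq_0)
      fix l assume l: "l \<in> {1, 3, 5}" "w = arm_end l"
      then have "l \<noteq> k'"
        using w by blast
      with l k'(2) show "arm_weight l t = 0"
        by blast
    qed (use w in simp_all)
  qed
  then show ?thesis
    using k'(1) by (rule bexI)
qed

lemma arm_end_edge: "{v, arm_end k} \<in> E" "arm_end k \<in> V" "arm_end k \<in> {a, b, c}" "arm_end k \<noteq> v"
  using edges in_V arms_ne by (auto simp: arm_end_def)

lemma arm_end_inj: "k \<in> {1, 3, 5} \<Longrightarrow> k' \<in> {1, 3, 5} \<Longrightarrow> k \<noteq> k' \<Longrightarrow> arm_end k \<noteq> arm_end k'"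
  using distinct_arms by (auto simp: arm_end_def)

lemma disjoint_pair_cells:
  "\<exists>\<sigma> \<tau>. \<sigma> \<in> simplices V E \<and> \<tau> \<in> simplices V E \<and> \<sigma> \<inter> \<tau> = {} \<and> \<sigma> \<subseteq> {v, a, b, c} \<and> \<tau> \<subseteq> {v, a, b, c} \<and>
     point t \<in> closed_cell V \<sigma> \<and> point (t + 1/2) \<in> closed_cell V \<tau>"
proof -
  obtain k where k: "k \<in> {1, 3, 5}" "arm_weight k t = 1 \<and> arm_weight k (t + 1/2) = 0 \<or>
      arm_weight k (t + 1/2) = 1 \<and> arm_weight k t = 0"
    using arm_weight_resting by blast
  have cells: "{arm_end k} \<in> simplices V E" "{v, arm_end k'} \<in> simplices V E"
    "{arm_end k} \<subseteq> {v, a, b, c}" "{v, arm_end k'} \<subseteq> {v, a, b, c}" for k'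
    using arm_end_edge by auto
  have disj: "{arm_end k} \<inter> {v, arm_end k'} = {}" if "k' \<in> {1, 3, 5} - {k}" for k'
    using arm_end_inj[OF k(1), of k'] that arm_end_edge(4) by auto
  from k(2) show ?thesis
  proof
    assume *: "arm_weight k t = 1 \<and> arm_weight k (t + 1/2) = 0"
    then obtain k' where "k' \<in> {1, 3, 5} - {k}" "point (t + 1/2) \<in> closed_cell V {v, arm_end k'}"
      using point_moving[OF k(1)] by blast
    then show ?thesis
      using * point_resting[OF k(1)] cells disj by (intro exI[of _ "{arm_end k}"] exI[of _ "{v, arm_end k'}"]) auto
  next
    assume *: "arm_weight k (t + 1/2) = 1 \<and> arm_weight k t = 0"
    then obtain k' where "k' \<in> {1, 3, 5} - {k}" "point t \<in> closed_cell V {v, arm_end k'}"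
      using point_moving[OF k(1)] by blast
    then show ?thesis
      using * point_resting[OF k(1)] cells disj[of k']
      by (intro exI[of _ "{arm_end k}"] exI[of _ "{v, arm_end k'}"]) (auto simp: Int_commute)
  qed
qed

lemma branch_weight_point:
  assumes "{w, d} \<in> E"
  shows "branch_weight E w d (point t) =
    (if a \<in> branch E w d then arm_weight 3 t else 0) + (if b \<in> branch E w d then arm_weight 5 t else 0) +
    (if c \<in> branch E w d then arm_weight 1 t else 0) + (if v \<in> branch E w d then centre_weight t else 0)"
  unfolding branch_weight_def
  by (rule sum_star_point[OF finite_V branch_subset[OF graph fin_graph_edge(2)[OF graph assms]]])

lemma arm_in_branch_iff:
  assumes "{v, d} \<in> E" "{v, d'} \<in> E"
  shows "d' \<in> branch E v d \<longleftrightarrow> d' = d"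
  using branch_disjoint[OF tree assms] self_in_branch[of d E v] self_in_branch[of d' E v] by auto

lemma branch_weight_own:
  assumes "{v, d} \<in> E"
  shows "branch_weight E v d (point t) =
    (if d = a then arm_weight 3 t else if d = b then arm_weight 5 t else if d = c then arm_weight 1 t else 0)"
  using distinct_arms not_in_branch[of d v E] fin_graph_edge(3)[OF graph assms]
  by (auto simp: branch_weight_point[OF assms] arm_in_branch_iff[OF assms] edges)

lemma same_branch:
  assumes "w \<noteq> v" "x \<in> {a, b, c}" "x \<noteq> w"
  shows "x \<in> branch E w d \<longleftrightarrow> v \<in> branch E w d"
  using branch_step[of v x E w d] assms edges by auto

text \<open>Seen from a vertex off the star, the whole star lies in one branch or outside
  it.\<close>

lemma branch_weight_other:
  assumes "{w, d} \<in> E" "w \<notin> {v, a, b, c}"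
  shows "branch_weight E w d (point t) = (if v \<in> branch E w d then 1 else 0)"
proof -
  have "x \<in> branch E w d \<longleftrightarrow> v \<in> branch E w d" if "x \<in> {a, b, c}" for x
    using same_branch[of w x d] that assms by auto
  then show ?thesis
    by (simp add: branch_weight_point[OF assms(1)] centre_weight_def)
qed

lemma branch_weight_other_zero:
  assumes "{w, d} \<in> E" "w \<noteq> v" "v \<notin> branch E w d"
  shows "branch_weight E w d (point t) = 0"
proof -
  have "x \<notin> branch E w d" if "x \<in> {a, b, c}" for x
    using same_branch[of w x d] not_in_branch[of d w E] fin_graph_edge(3)[OF graph assms(1)] that assms
    by (cases "x = w") auto
  then show ?thesis
    using assms by (simp add: branch_weight_point[OF assms(1)])
qed

text \<open>Here \<open>w\<close> may be the end of an arm, as can happen for n = 2, when essential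
  vertices may be adjacent. What is left of the star without \<open>w\<close> still hangs together
  through \<open>v\<close>, so it misses one of the two branches and one weight is 0.\<close>

lemma pair_phase_other_star:
  assumes d: "{w, d} \<in> E" "{w, d'} \<in> E" "d \<noteq> d'" and w: "w \<noteq> v"
  shows "pair_phase E w d d' (point t) (point t') = 1"
proof -
  have "v \<notin> branch E w d \<or> v \<notin> branch E w d'"
    using branch_disjoint[OF tree d] by auto
  then have "branch_weight E w d (point t) * branch_weight E w d' (point t') = 0"
    using branch_weight_other_zero[OF d(1) w] branch_weight_other_zero[OF d(2) w] by auto
  then show ?thesis
    by (auto simp: pair_phase_def)
qed

lemma pair_phase_exchange:
  "pair_phase E v a b (point t) (point (t + 1/2)) = cis (2 * pi * exchange_lift t)"
proof -
  have "branch_weight E v a (point t) = arm_weight 3 t" "branch_weight E v b (point (t + 1/2)) = arm_weight 5 (t + 1/2)"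
    using distinct_arms by (simp_all add: branch_weight_own edges)
  then show ?thesis
    unfolding pair_phase_def point_centre by (simp only: cis_exchange_lift)
qed

lemma pair_phase_unused:
  assumes "{v, d} \<in> E" "d \<notin> {a, b, c}"
  shows "pair_phase E v a d (point t) (point t') = 1"
  using assms by (simp add: pair_phase_def branch_weight_own edges)

end

section \<open>Independent pairs on disjoint tripods\<close>

locale tripod_torus =
  fixes V :: "'a set" and E :: "'a set set" and n r :: nat and u a b c :: "nat \<Rightarrow> 'a" and x\<^sub>0 :: 'a
  assumes n: "n = 2 * r \<or> n = 2 * r + 1"
    and tree: "fin_tree V E"
    and tripods: "\<And>i. i < r \<Longrightarrow> tripod V E (u i) (a i) (b i) (c i)"
    and stars_disjoint: "\<And>i j. i < r \<Longrightarrow> j < r \<Longrightarrow> i \<noteq> j \<Longrightarrow>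
      {u i, a i, b i, c i} \<inter> {u j, a j, b j, c j} = {}"
    and x0: "x\<^sub>0 \<in> V"
    and x0_off: "\<And>i. i < r \<Longrightarrow> n = 2 * r + 1 \<Longrightarrow> x\<^sub>0 \<notin> {u i, a i, b i, c i}"
begin

lemma graph: "fin_graph V E"
  using tree by (simp add: fin_tree_def)

lemma finite_V: "finite V"
  using graph by (simp add: fin_graph_def)

definition base :: "nat \<Rightarrow> 'a set" where
  "base p = (if p div 2 < r then {u (p div 2), a (p div 2), b (p div 2), c (p div 2)} else {x\<^sub>0})"

text \<open>Particles 2i and 2i + 1 share the i-th star, the odd one shifted by half a period. For
  odd n the last index 2r is the particle at rest.\<close>

definition particle :: "(nat \<Rightarrow> real) \<Rightarrow> nat \<Rightarrow> 'a \<Rightarrow> real" where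
  "particle \<theta> p = (if p div 2 < r
     then star_point V (u (p div 2)) (a (p div 2)) (b (p div 2)) (c (p div 2))
            (\<theta> (p div 2) + (if even p then 0 else 1/2))
     else vertex_point V x\<^sub>0)"

definition config :: "(nat \<Rightarrow> real) \<Rightarrow> nat \<Rightarrow> 'a \<Rightarrow> real" where
  "config \<theta> = (\<lambda>p\<in>{..<n}. particle \<theta> p)"

lemma base_disjoint:
  assumes "p < n" "q < n" "p div 2 \<noteq> q div 2"
  shows "base p \<inter> base q = {}"
proof -
  have *: "n = 2 * r + 1" if "\<not> p div 2 < r" "p < n" for p
    using n that by auto
  consider "p div 2 < r" "q div 2 < r" | "p div 2 < r" "\<not> q div 2 < r" | "\<not> p div 2 < r" "q div 2 < r"
    | "\<not> p div 2 < r" "\<not> q div 2 < r"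
    by blast
  then show ?thesis
  proof cases
    case 1
    then show ?thesis
      using stars_disjoint[OF 1 assms(3)] by (simp add: base_def)
  next
    case 2
    then show ?thesis
      using x0_off[OF 2(1) *[OF 2(2) assms(2)]] by (simp add: base_def)
  next
    case 3
    then show ?thesis
      using x0_off[OF 3(2) *[OF 3(1) assms(1)]] by (simp add: base_def)
  next
    case 4
    then have "2 * r \<le> p" "2 * r \<le> q"
      by auto
    then have "p = q"
      using assms n by auto
    with assms show ?thesis by simp
  qed
qed

lemma particle_cells:
  obtains \<sigma> where "\<And>p. p < n \<Longrightarrow> \<sigma> p \<in> simplices V E"
    "\<And>p. p < n \<Longrightarrow> particle \<theta> p \<in> closed_cell V (\<sigma> p)" "\<And>p. p < n \<Longrightarrow> \<sigma> p \<subseteq> base p"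
    "\<And>p q. p < n \<Longrightarrow> q < n \<Longrightarrow> p \<noteq> q \<Longrightarrow> \<sigma> p \<inter> \<sigma> q = {}"
proof -
  define Q where "Q = (\<lambda>i \<sigma> \<tau>. \<sigma> \<in> simplices V E \<and> \<tau> \<in> simplices V E \<and> \<sigma> \<inter> \<tau> = {} \<and>
      \<sigma> \<subseteq> {u i, a i, b i, c i} \<and> \<tau> \<subseteq> {u i, a i, b i, c i} \<and>
      star_point V (u i) (a i) (b i) (c i) (\<theta> i) \<in> closed_cell V \<sigma> \<and>
      star_point V (u i) (a i) (b i) (c i) (\<theta> i + 1/2) \<in> closed_cell V \<tau>)"
  have "\<exists>\<sigma> \<tau>. Q i \<sigma> \<tau>" if "i < r" for i
    unfolding Q_def by (rule tripod.disjoint_pair_cells[OF tripods[OF that]])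
  then obtain \<sigma> \<tau> where st: "\<And>i. i < r \<Longrightarrow> Q i (\<sigma> i) (\<tau> i)"
    by metis
  define S where "S = (\<lambda>p. if p div 2 < r then if even p then \<sigma> (p div 2) else \<tau> (p div 2) else {x\<^sub>0})"
  have sub: "S p \<subseteq> base p" for p
    using st[of "p div 2"] by (simp add: S_def base_def Q_def)
  have "S p \<inter> S q = {}" if pq: "p < n" "q < n" "p \<noteq> q" for p q
  proof (cases "p div 2 = q div 2")
    case True
    have "p div 2 < r"
    proof (rule ccontr)
      assume "\<not> p div 2 < r"
      then have "2 * r \<le> p" "2 * r \<le> q"
        using True by auto
      then show False
        using pq n by auto
    qed
    moreover have "even p \<noteq> even q"
    proof
      assume eo: "even p = even q"
      have "p = 2 * (p div 2) + p mod 2" "q = 2 * (q div 2) + q mod 2"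
        by simp_all
      moreover have "p mod 2 = q mod 2"
        using eo by (simp add: even_iff_mod_2_eq_zero odd_iff_mod_2_eq_one) presburger
      ultimately show False
        using True pq(3) by metis
    qed
    ultimately show ?thesis
      using st[of "p div 2"] True by (auto simp: S_def Q_def)
  next
    case False
    then show ?thesis
      using base_disjoint[OF pq(1,2)] sub[of p] sub[of q] by blast
  qed
  moreover have "S p \<in> simplices V E \<and> particle \<theta> p \<in> closed_cell V (S p)" for p
    using st[of "p div 2"] x0 vertex_point_in_cell[OF finite_V x0] by (simp add: S_def particle_def Q_def)
  ultimately show thesis
    using sub by (intro that[of S]) simp_all
qed

lemma config_in_discrete_conf: "config \<theta> \<in> discrete_conf_set V E n"
proof -
  obtain \<sigma> where \<sigma>: "\<And>p. p < n \<Longrightarrow> \<sigma> p \<in> simplices V E"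
    "\<And>p. p < n \<Longrightarrow> particle \<theta> p \<in> closed_cell V (\<sigma> p)" "\<And>p. p < n \<Longrightarrow> \<sigma> p \<subseteq> base p"
    "\<And>p q. p < n \<Longrightarrow> q < n \<Longrightarrow> p \<noteq> q \<Longrightarrow> \<sigma> p \<inter> \<sigma> q = {}"
    by (rule particle_cells[of \<theta>]) (rule that; simp)
  let ?c = "\<lambda>p. closed_cell V (\<sigma> p)"
  have "config \<theta> \<in> (\<Pi>\<^sub>E p\<in>{..<n}. ?c p)"
    using \<sigma>(2) by (simp add: config_def PiE_iff)
  moreover have "\<forall>p<n. ?c p \<in> closed_cells V E"
    using \<sigma>(1) by (simp add: closed_cells_def)
  moreover have "disjoint_family_on ?c {..<n}"
    unfolding disjoint_family_on_def using \<sigma>(4) by (intro ballI impI disjoint_cells) simp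
  ultimately show ?thesis
    unfolding discrete_conf_set_eq by (intro UnionI[of "\<Pi>\<^sub>E p\<in>{..<n}. ?c p"] CollectI exI[of _ ?c]) simp_all
qed

lemma particle_off_base:
  assumes "p < n" "w \<in> V" "w \<notin> base p"
  shows "particle \<theta> p w = 0"
proof -
  obtain \<sigma> where \<sigma>: "\<And>p. p < n \<Longrightarrow> \<sigma> p \<in> simplices V E"
    "\<And>p. p < n \<Longrightarrow> particle \<theta> p \<in> closed_cell V (\<sigma> p)" "\<And>p. p < n \<Longrightarrow> \<sigma> p \<subseteq> base p"
    "\<And>p q. p < n \<Longrightarrow> q < n \<Longrightarrow> p \<noteq> q \<Longrightarrow> \<sigma> p \<inter> \<sigma> q = {}"
    by (rule particle_cells[of \<theta>]) (rule that; simp)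
  from \<sigma>(2,3)[OF assms(1)] show ?thesis
    using assms by (auto simp: closed_cell_def)
qed

lemma continuous_config: "continuous_map euclidean (discrete_conf V E n) config"
proof -
  have weight: "continuous_on UNIV (\<lambda>\<theta>. particle \<theta> p w)" if "w \<in> V" for p w
  proof -
    have *: "continuous_on UNIV (\<lambda>\<theta>. arm_weight k (\<theta> (i::nat) + s))" if "k \<in> {1, 3, 5}" for k i s
      by (rule continuous_on_compose2[OF continuous_arm_weight[OF that]]) (auto intro!: continuous_intros)
    have **: "continuous_on UNIV (\<lambda>\<theta>. if P then f \<theta> else (0::real))" if "continuous_on UNIV f"
      for P and f :: "(nat \<Rightarrow> real) \<Rightarrow> real"
      using that by (cases P) auto
    show ?thesis
    proof (cases "p div 2 < r")
      case True
      then show ?thesis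
        using \<open>w \<in> V\<close> unfolding particle_def star_point_def centre_weight_def
        by (simp only: if_True restrict_apply') (intro continuous_intros * **; simp)
    next
      case False
      then show ?thesis
        by (simp add: particle_def)
    qed
  qed
  have "continuous_map euclidean (realization V E) (\<lambda>\<theta>. config \<theta> p)" if p: "p < n" for p
    unfolding realization_def continuous_map_in_subtopology
  proof
    have "config \<theta> p \<in> \<Union>(closed_cells V E)" for \<theta>
      using config_in_discrete_conf[of \<theta>] p
      unfolding discrete_conf_set_def configurations_def topspace_realization[symmetric] power_space_def by auto
    then show "(\<lambda>\<theta>. config \<theta> p) \<in> topspace euclidean \<rightarrow> \<Union>(closed_cells V E)"
      by blast
    have "particle \<theta> p \<in> extensional V" for \<theta>
      by (simp add: particle_def star_point_def vertex_point_def)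
    then show "continuous_map euclidean (powertop_real V) (\<lambda>\<theta>. config \<theta> p)"
      unfolding continuous_map_componentwise using p weight by (auto simp: config_def)
  qed
  then have "continuous_map euclidean (power_space n (realization V E)) config"
    unfolding power_space_def continuous_map_componentwise by (auto simp: config_def)
  then show ?thesis
    unfolding discrete_conf_def continuous_map_in_subtopology using config_in_discrete_conf by auto
qed

lemma config_add_Ints:
  assumes "\<And>j. z j \<in> \<int>"
  shows "config (\<lambda>j. \<theta> j + z j) = config \<theta>"
proof -
  have "particle (\<lambda>j. \<theta> j + z j) p = particle \<theta> p" for p
    using star_point_add_Ints[OF assms, of V _ _ _ _ "\<theta> (p div 2) + (if even p then 0 else 1/2)" "p div 2"]
    by (simp add: particle_def algebra_simps)
  then show ?thesis
    by (simp add: config_def)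
qed

lemma pair_phase_particle_eq_1:
  assumes v: "v \<in> V" and d: "{v, d} \<in> E" "{v, d'} \<in> E" and pq: "p < n" "q < n" "v \<notin> base p"
  shows "pair_phase E v d d' (particle \<theta> p) (particle \<theta> q) = 1"
proof -
  obtain \<sigma> where \<sigma>: "\<And>p. p < n \<Longrightarrow> \<sigma> p \<in> simplices V E"
    "\<And>p. p < n \<Longrightarrow> particle \<theta> p \<in> closed_cell V (\<sigma> p)" "\<And>p. p < n \<Longrightarrow> \<sigma> p \<subseteq> base p"
    "\<And>p q. p < n \<Longrightarrow> q < n \<Longrightarrow> p \<noteq> q \<Longrightarrow> \<sigma> p \<inter> \<sigma> q = {}"
    by (rule particle_cells[of \<theta>]) (rule that; simp)
  note d1 = fin_graph_edge(2,3)[OF graph d(1)] and d2 = fin_graph_edge(2,3)[OF graph d(2)]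
  show ?thesis
    by (rule pair_phase_eq_1[OF graph v d1(1) d1(2)[symmetric] d2(1) d2(2)[symmetric]
          \<sigma>(1)[OF pq(1)] \<sigma>(2)[OF pq(1)] \<sigma>(1)[OF pq(2)] \<sigma>(2)[OF pq(2)] particle_off_base[OF pq(1) v pq(3)]])
qed

lemma phase_config: "phase E n v d d' (config \<theta>) =
    (\<Prod>p<n. \<Prod>q\<in>{..<n} - {p}. pair_phase E v d d' (particle \<theta> p) (particle \<theta> q))"
  unfolding phase_def config_def by (intro prod.cong) auto

lemma phase_far:
  assumes "v \<in> V" "{v, d} \<in> E" "{v, d'} \<in> E" "\<And>p. p < n \<Longrightarrow> v \<notin> base p"
  shows "phase E n v d d' (config \<theta>) = 1"
  unfolding phase_config using assms by (intro prod.neutral ballI pair_phase_particle_eq_1) auto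

lemma phase_two_particles:
  assumes "n = 2" "{v, d} \<in> E" "{v, d'} \<in> E" "d \<noteq> d'" "v \<noteq> u 0"
  shows "phase E n v d d' (config \<theta>) = 1"
proof -
  have r: "0 < r"
    using n assms(1) by auto
  then have star: "tripod V E (u 0) (a 0) (b 0) (c 0)"
    using tripods by simp
  show ?thesis
    unfolding phase_config
  proof (intro prod.neutral ballI)
    fix p q assume "p \<in> {..<n}" "q \<in> {..<n} - {p}"
    then have "p div 2 = 0" "q div 2 = 0"
      using assms(1) by auto
    then show "pair_phase E v d d' (particle \<theta> p) (particle \<theta> q) = 1"
      using tripod.pair_phase_other_star[OF star assms(2-5)] r by (simp add: particle_def)
  qed
qed

text \<open>A particle of another star never passes through \<open>u i\<close>, so its branch as
  seen from there is fixed; the zero angles merely provide a reference value.\<close>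

lemma branch_weight_particle:
  assumes i: "i < r" and d: "{u i, d} \<in> E" and q: "q < n" "q div 2 \<noteq> i"
  shows "branch_weight E (u i) d (particle \<theta> q) = branch_weight E (u i) d (particle (\<lambda>_. 0) q)"
proof (cases "q div 2 < r")
  case True
  interpret tripod V E "u (q div 2)" "a (q div 2)" "b (q div 2)" "c (q div 2)"
    by (rule tripods[OF True])
  have "u i \<notin> {u (q div 2), a (q div 2), b (q div 2), c (q div 2)}"
    using stars_disjoint[OF i True] q by auto
  then show ?thesis
    using True by (simp add: particle_def branch_weight_other[OF d])
qed (simp add: particle_def)

lemma prod_cis: "(\<Prod>q\<in>A. cis (f q)) = cis (\<Sum>q\<in>A. f q)"
  by (induction A rule: infinite_finite_induct) (simp_all add: cis_mult)

text \<open>Only the two particles of the i-th star ever have weight at \<open>u i\<close>. Each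
  meets its partner, which gives the lift of the exchange if \<open>d = b i\<close>, and all other
  particles, whose constant weights in the branch of \<open>d\<close> add up to \<open>M\<close>.
  The second contribution follows the position in the arm \<open>a i\<close> and is
  periodic.\<close>

lemma phase_near:
  assumes i: "i < r" and d: "{u i, d} \<in> E" "d \<notin> {a i, c i}"
  shows "\<exists>M. \<forall>\<theta>. phase E n (u i) (a i) d (config \<theta>) =
    cis (2 * pi * ((if d = b i then exchange_lift (\<theta> i) + exchange_lift (\<theta> i + 1/2) else 0) +
      M * (arm_weight 3 (\<theta> i) + arm_weight 3 (\<theta> i + 1/2))))"
proof -
  interpret star: tripod V E "u i" "a i" "b i" "c i"
    by (rule tripods[OF i])
  define R where "R = {..<n} - {2 * i, 2 * i + 1}"
  define M where "M = (\<Sum>q\<in>R. branch_weight E (u i) d (particle (\<lambda>_. 0) q))"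
  have R: "q < n" "q div 2 \<noteq> i" if "q \<in> R" for q
    using that by (auto simp: R_def)
  have lt: "2 * i < n" "2 * i + 1 < n"
    using n i by auto
  have off: "u i \<notin> base q" if "q \<in> R" for q
    using base_disjoint[of "2 * i" q] R[OF that] lt i by (auto simp: base_def)
  show ?thesis
  proof (intro exI allI)
    fix \<theta> :: "nat \<Rightarrow> real"
    define t where "t = \<theta> i"
    define w where "w = (\<lambda>p q. pair_phase E (u i) (a i) d (particle \<theta> p) (particle \<theta> q))"
    have P: "particle \<theta> (2 * i) = star.point t" "particle \<theta> (2 * i + 1) = star.point (t + 1/2)"
      using i by (simp_all add: particle_def t_def)
    have rest: "pair_phase E (u i) (a i) d (star.point s) (particle \<theta> q) =
        cis (2 * pi * arm_weight 3 s * branch_weight E (u i) d (particle (\<lambda>_. 0) q))" if q: "q \<in> R" for q s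
    proof -
      have "particle \<theta> q (u i) = 0"
        by (rule particle_off_base[OF R(1)[OF q] star.in_V(1) off[OF q]])
      then show ?thesis
        using branch_weight_particle[OF i d(1) R[OF q], of \<theta>] star.branch_weight_own[OF star.edges(1), of s]
        by (simp add: pair_phase_def star.point_centre centre_weight_nonneg mult.assoc)
    qed
    have prod_rest: "(\<Prod>q\<in>R. pair_phase E (u i) (a i) d (star.point s) (particle \<theta> q)) =
        cis (2 * pi * (M * arm_weight 3 s))" for s
    proof -
      have "(\<Prod>q\<in>R. pair_phase E (u i) (a i) d (star.point s) (particle \<theta> q)) =
          (\<Prod>q\<in>R. cis (2 * pi * arm_weight 3 s * branch_weight E (u i) d (particle (\<lambda>_. 0) q)))"
        by (rule prod.cong) (simp_all add: rest)
      also have "\<dots> = cis (2 * pi * (M * arm_weight 3 s))"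
        by (simp only: prod_cis sum_distrib_left[symmetric] M_def[symmetric] mult.assoc mult.commute[of M])
      finally show ?thesis .
    qed
    have pair: "pair_phase E (u i) (a i) d (star.point s) (star.point (s + 1/2)) =
        cis (2 * pi * (if d = b i then exchange_lift s else 0))" for s
      using star.pair_phase_exchange[of s] star.pair_phase_unused[OF d(1), of s "s + 1/2"] d(2) by simp
    \<comment> \<open>The even particle is half a period after the odd one as well, so one formula
      for a pair serves both orders.\<close>
    have half: "star.point (t + 1/2 + 1/2) = star.point t"
      using star_point_add_Ints[of 1 V "u i" "a i" "b i" "c i" t] by (simp add: add.commute)
    have "phase E n (u i) (a i) d (config \<theta>) = (\<Prod>p<n. \<Prod>q\<in>{..<n} - {p}. w p q)"
      by (simp add: phase_config w_def)
    also have "\<dots> = (\<Prod>p\<in>{2 * i, 2 * i + 1}. \<Prod>q\<in>{..<n} - {p}. w p q)"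
    proof (rule prod.mono_neutral_right)
      show "\<forall>p\<in>{..<n} - {2 * i, 2 * i + 1}. (\<Prod>q\<in>{..<n} - {p}. w p q) = 1"
        unfolding w_def using off star.in_V(1) star.edges(1) d(1)
        by (intro ballI prod.neutral pair_phase_particle_eq_1) (auto simp: R_def)
    qed (use lt in auto)
    also have "\<dots> = (\<Prod>q\<in>{..<n} - {2 * i}. w (2 * i) q) * (\<Prod>q\<in>{..<n} - {2 * i + 1}. w (2 * i + 1) q)"
      by simp
    finally have split: "phase E n (u i) (a i) d (config \<theta>) =
        (\<Prod>q\<in>{..<n} - {2 * i}. w (2 * i) q) * (\<Prod>q\<in>{..<n} - {2 * i + 1}. w (2 * i + 1) q)" .
    have ins: "{..<n} - {2 * i} = insert (2 * i + 1) R" "{..<n} - {2 * i + 1} = insert (2 * i) R"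
      using lt by (auto simp: R_def)
    have "(\<Prod>q\<in>insert (2 * i + 1) R. w (2 * i) q) = cis (2 * pi * (if d = b i then exchange_lift t else 0)) *
        cis (2 * pi * (M * arm_weight 3 t))"
    proof -
      have "(\<Prod>q\<in>insert (2 * i + 1) R. w (2 * i) q) = w (2 * i) (2 * i + 1) * (\<Prod>q\<in>R. w (2 * i) q)"
        by (rule prod.insert) (auto simp: R_def)
      then show ?thesis
        by (simp only: w_def P pair prod_rest)
    qed
    moreover have "(\<Prod>q\<in>insert (2 * i) R. w (2 * i + 1) q) =
        cis (2 * pi * (if d = b i then exchange_lift (t + 1/2) else 0)) *
        cis (2 * pi * (M * arm_weight 3 (t + 1/2)))"
    proof -
      have "(\<Prod>q\<in>insert (2 * i) R. w (2 * i + 1) q) = w (2 * i + 1) (2 * i) * (\<Prod>q\<in>R. w (2 * i + 1) q)"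
        by (rule prod.insert) (auto simp: R_def)
      moreover have "w (2 * i + 1) (2 * i) = cis (2 * pi * (if d = b i then exchange_lift (t + 1/2) else 0))"
        using pair[of "t + 1/2"] half by (simp only: w_def P)
      ultimately show ?thesis
        by (simp only: w_def P prod_rest)
    qed
    ultimately have "phase E n (u i) (a i) d (config \<theta>) =
        cis (2 * pi * (if d = b i then exchange_lift t else 0)) * cis (2 * pi * (M * arm_weight 3 t)) *
        (cis (2 * pi * (if d = b i then exchange_lift (t + 1/2) else 0)) *
         cis (2 * pi * (M * arm_weight 3 (t + 1/2))))"
      by (simp only: split ins)
    then show "phase E n (u i) (a i) d (config \<theta>) =
      cis (2 * pi * ((if d = b i then exchange_lift (\<theta> i) + exchange_lift (\<theta> i + 1/2) else 0) +
        M * (arm_weight 3 (\<theta> i) + arm_weight 3 (\<theta> i + 1/2))))"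
      by (cases "d = b i") (simp_all add: cis_mult t_def algebra_simps)
  qed
qed

end

context tripod_torus
begin

text \<open>The winding is 2 because in one period each of the two particles enters
  \<open>a i\<close> once while its partner sits at \<open>b i\<close>.\<close>

lemma phase_lift:
  assumes i: "i < r"
  shows "\<exists>H. continuous_on UNIV H \<and> (\<forall>t z. z \<in> \<int> \<longrightarrow> H (t + z) = H t + 2 * z) \<and>
    (\<forall>\<theta>. phase E n (u i) (a i) (b i) (config \<theta>) = cis (2 * pi * H (\<theta> i)))"
proof -
  interpret star: tripod V E "u i" "a i" "b i" "c i"
    by (rule tripods[OF i])
  have "b i \<notin> {a i, c i}"
    using star.distinct_arms by simp
  then obtain M where M: "\<forall>\<theta>. phase E n (u i) (a i) (b i) (config \<theta>) =
    cis (2 * pi * ((if b i = b i then exchange_lift (\<theta> i) + exchange_lift (\<theta> i + 1/2) else 0) +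
      M * (arm_weight 3 (\<theta> i) + arm_weight 3 (\<theta> i + 1/2))))"
    using phase_near[OF i star.edges(2)] by blast
  let ?H = "\<lambda>t. (exchange_lift t + exchange_lift (t + 1/2)) + M * (arm_weight 3 t + arm_weight 3 (t + 1/2))"
  have "continuous_on UNIV ?H"
    by (intro continuous_intros continuous_on_compose2[OF continuous_exchange_lift]
        continuous_on_compose2[OF continuous_arm_weight]) auto
  moreover have "?H (t + z) = ?H t + 2 * z" if z: "z \<in> \<int>" for t z
  proof -
    have "t + z + 1/2 = t + 1/2 + z"
      by simp
    then show ?thesis
      by (simp only: exchange_lift_add_Ints[OF z] arm_weight_add_Ints[OF z])
  qed
  ultimately show ?thesis
    using M by (intro exI[of _ ?H]) simp
qed

lemma phase_lift_unused:
  assumes i: "i < r" and d: "{u i, d} \<in> E" "d \<notin> {a i, b i, c i}"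
  shows "\<exists>H. continuous_on UNIV H \<and> (\<forall>t z. z \<in> \<int> \<longrightarrow> H (t + z) = H t) \<and>
    (\<forall>\<theta>. phase E n (u i) (a i) d (config \<theta>) = cis (2 * pi * H (\<theta> i)))"
proof -
  have "d \<notin> {a i, c i}" "d \<noteq> b i"
    using d by simp_all
  then obtain M where M: "\<forall>\<theta>. phase E n (u i) (a i) d (config \<theta>) =
    cis (2 * pi * ((if d = b i then exchange_lift (\<theta> i) + exchange_lift (\<theta> i + 1/2) else 0) +
      M * (arm_weight 3 (\<theta> i) + arm_weight 3 (\<theta> i + 1/2))))"
    using phase_near[OF i d(1)] by blast
  let ?H = "\<lambda>t. M * (arm_weight 3 t + arm_weight 3 (t + 1/2))"
  have "continuous_on UNIV ?H"
    by (intro continuous_intros continuous_on_compose2[OF continuous_arm_weight]) auto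
  moreover have "?H (t + z) = ?H t" if z: "z \<in> \<int>" for t z
  proof -
    have "t + z + 1/2 = t + 1/2 + z"
      by simp
    then show ?thesis
      by (simp only: arm_weight_add_Ints[OF z])
  qed
  ultimately show ?thesis
    using M \<open>d \<noteq> b i\<close> by (intro exI[of _ ?H]) simp
qed

end

section \<open>The lower bound from s tori\<close>

lemma continuous_map_perm_orbit:
  "continuous_map (discrete_conf V E n) (unordered_discrete_conf V E n) (perm_orbit n)"
  unfolding unordered_discrete_conf_def
  by (rule quotient_imp_continuous_map[OF quotient_map_quotient_topology])

text \<open>The arms \<open>A\<close> and \<open>C\<close> at a vertex are common to all tori;
  \<open>B\<close> may vary. By \<open>sep\<close>, some torus \<open>j'\<close> either does not use
  the vertex or uses it without the arm \<open>B j\<close>, and in both cases the phase of the pair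
  \<open>A\<close>, \<open>B j\<close> lifts to the real line there.\<close>

lemma TC_ge_of_tripods:
  fixes u :: "nat \<Rightarrow> nat \<Rightarrow> 'a" and A C :: "'a \<Rightarrow> 'a" and B :: "nat \<Rightarrow> 'a \<Rightarrow> 'a"
  assumes T: "fin_tree V E" and s: "2 \<le> s" and r: "0 < r" and n: "n = 2 * r \<or> n = 2 * r + 1"
    and sub: "sufficiently_subdivided V E n"
    and deg: "\<And>j i. j < s \<Longrightarrow> i < r \<Longrightarrow> 3 \<le> vertex_degree E (u j i)"
    and inj: "\<And>j. j < s \<Longrightarrow> inj_on (u j) {..<r}"
    and tri: "\<And>j i. j < s \<Longrightarrow> i < r \<Longrightarrow> tripod V E (u j i) (A (u j i)) (B j (u j i)) (C (u j i))"
    and sep: "\<And>j i. j < s \<Longrightarrow> i < r \<Longrightarrow>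
      \<exists>j'<s. \<forall>i'<r. u j' i' = u j i \<longrightarrow> B j' (u j i) \<noteq> B j (u j i)"
  shows "enat (s * r) \<le> TC s (unordered_discrete_conf V E n)"
proof -
  have G: "fin_graph V E"
    using T by (simp add: fin_tree_def)
  obtain x0 where x0: "x0 \<in> V" "vertex_degree E x0 \<le> 1"
    using ex_vertex_degree_le_1[OF T] by blast
  let ?st = "\<lambda>j i. {u j i, A (u j i), B j (u j i), C (u j i)}"
  have adjacent: "n \<le> 2" if "{x, y} \<in> E" "vertex_degree E x \<noteq> 2" "vertex_degree E y \<noteq> 2" for x y
    using sufficiently_subdivided_adjacent[OF G sub] that by blast
  have star_edge: "w = u j i \<or> {u j i, w} \<in> E" if "j < s" "i < r" "w \<in> ?st j i" for j i w
    using tripod.edges[OF tri[OF that(1,2)]] that(3) by auto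
  have deg2: "vertex_degree E (u j i) \<noteq> 2" if "j < s" "i < r" for j i
    using deg[OF that] by simp
  have torus: "tripod_torus V E n r (u j) (\<lambda>i. A (u j i)) (\<lambda>i. B j (u j i)) (\<lambda>i. C (u j i)) x0" if j: "j < s" for j
  proof (rule tripod_torus.intro)
    fix i i' assume i: "i < r" "i' < r" "i \<noteq> i'"
    then have n4: "4 \<le> n"
      using n by auto
    have ne: "u j i \<noteq> u j i'"
      using inj_onD[OF inj[OF j], of i i'] i by auto
    show "?st j i \<inter> ?st j i' = {}"
    proof (rule ccontr)
      assume "?st j i \<inter> ?st j i' \<noteq> {}"
      then obtain w where "w \<in> ?st j i" "w \<in> ?st j i'"
        by blast
      then have "w = u j i \<or> {u j i, w} \<in> E" "w = u j i' \<or> {u j i', w} \<in> E"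
        using star_edge j i by blast+
      then have "n \<le> 3"
        using ne adjacent[of "u j i" "u j i'"] adjacent[of "u j i'" "u j i"] deg2[OF j i(1)] deg2[OF j i(2)]
          sufficiently_subdivided_common_neighbour[OF G sub ne, of w] by fastforce
      then show False
        using n4 by simp
    qed
  next
    fix i assume i: "i < r" "n = 2 * r + 1"
    show "x0 \<notin> ?st j i"
    proof
      assume "x0 \<in> ?st j i"
      then have "x0 = u j i \<or> {u j i, x0} \<in> E"
        using star_edge j i by blast
      then show False
        using adjacent[of "u j i" x0] deg[OF j i(1)] deg2[OF j i(1)] x0 i r by auto
    qed
  qed (fact n, fact T, erule tri[OF j], fact x0(1))
  define conf where "conf = (\<lambda>j. tripod_torus.config V n r (u j) (\<lambda>i. A (u j i)) (\<lambda>i. B j (u j i)) (\<lambda>i. C (u j i)) x0)"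
  have conf_eq: "conf j = tripod_torus.config V n r (u j) (\<lambda>i. A (u j i)) (\<lambda>i. B j (u j i)) (\<lambda>i. C (u j i)) x0" for j
    by (simp add: conf_def)
  \<comment> \<open>Circle i of torus j is coordinate \<open>j * r + i\<close> of the big torus;
    quotient and remainder by \<open>r\<close> recover j and i below.\<close>
  define sh where "sh = (\<lambda>(\<theta> :: nat \<Rightarrow> real) j i. \<theta> (j * r + i))"
  let ?X = "unordered_discrete_conf V E n"
  define \<Phi> where "\<Phi> = (\<lambda>\<theta>. \<lambda>j\<in>{..<s}. perm_orbit n (conf j (sh \<theta> j)))"
  have conf_in: "conf j \<theta> \<in> discrete_conf_set V E n" if "j < s" for j \<theta>
    unfolding conf_def by (rule tripod_torus.config_in_discrete_conf[OF torus[OF that]])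
  have sh: "continuous_on UNIV (\<lambda>\<theta>. sh \<theta> j)" for j
    unfolding sh_def by (intro continuous_on_coordinatewise_then_product) (auto intro!: continuous_intros)
  have \<Phi>: "continuous_map euclidean (power_space s ?X) \<Phi>"
    unfolding power_space_def continuous_map_componentwise
  proof (intro conjI ballI)
    show "\<Phi> ` topspace euclidean \<subseteq> extensional {..<s}"
      by (auto simp: \<Phi>_def)
    fix j assume j: "j \<in> {..<s}"
    have "continuous_map euclidean (discrete_conf V E n) (conf j)"
      unfolding conf_def using tripod_torus.continuous_config[OF torus] j by simp
    moreover have "continuous_map euclidean euclidean (\<lambda>\<theta>. sh \<theta> j)"
      using sh by simp
    ultimately have "continuous_map euclidean ?X (perm_orbit n \<circ> (conf j \<circ> (\<lambda>\<theta>. sh \<theta> j)))"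
      by (intro continuous_map_compose[OF _ continuous_map_perm_orbit]) (rule continuous_map_compose)
    then show "continuous_map euclidean ?X (\<lambda>\<theta>. \<Phi> \<theta> j)"
      using j by (simp add: \<Phi>_def o_def)
  qed
  have \<Phi>per: "\<Phi> (\<lambda>j. \<theta> j + z j) = \<Phi> \<theta>" if z: "\<And>j. z j \<in> \<int>" for \<theta> z
  proof -
    have "conf j (sh (\<lambda>j. \<theta> j + z j) j) = conf j (sh \<theta> j)" if "j < s" for j
      unfolding sh_def conf_def by (rule tripod_torus.config_add_Ints[OF torus[OF that]]) (rule z)
    then show ?thesis
      unfolding \<Phi>_def by (intro restrict_ext) simp
  qed
  \<comment> \<open>The last clause is the diagonal shape: the x-th function winds twice along
    circle x and along no other.\<close>
  define Q where "Q = (\<lambda>x f p q (h :: (nat \<Rightarrow> real) \<Rightarrow> real). continuous_map ?X euclidean f \<and> (\<forall>y\<in>topspace ?X. f y \<noteq> (0::complex)) \<and>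
     p < s \<and> q < s \<and> continuous_on UNIV h \<and> (\<forall>\<theta>. f (\<Phi> \<theta> p) = cis (2 * pi * h \<theta>) * f (\<Phi> \<theta> q)) \<and>
     (\<forall>\<theta> z. (\<forall>j. z j \<in> \<int>) \<longrightarrow> h (\<lambda>j. \<theta> j + z j) = h \<theta> + 2 * z x))"
  have "\<exists>f p q h. Q x f p q h" if x: "x < s * r" for x
  proof -
    define j where "j = x div r"
    define i where "i = x mod r"
    have j: "j < s"
      using x by (simp add: j_def less_mult_imp_div_less)
    have i: "i < r"
      using r by (simp add: i_def)
    have xji: "j * r + i = x"
      by (simp add: j_def i_def)
    define v where "v = u j i"
    have tv: "tripod V E v (A v) (B j v) (C v)"
      using tri[OF j i] by (simp add: v_def)
    note e = tripod.edges[OF tv] and dist = tripod.distinct_arms[OF tv]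
    have v: "v \<in> V"
      by (rule fin_graph_edge(1)[OF G e(1)])
    note ea = fin_graph_edge(2,3)[OF G e(1)] and eb = fin_graph_edge(2,3)[OF G e(2)]
    obtain j' where j'': "j' < s \<and> (\<forall>i'<r. u j' i' = v \<longrightarrow> B j' v \<noteq> B j v)"
      using sep[OF j i, folded v_def] ..
    note j' = j''[THEN conjunct1] j''[THEN conjunct2, rule_format]
    obtain f where f: "continuous_map ?X euclidean f"
      "\<And>x. x \<in> discrete_conf_set V E n \<Longrightarrow> f (perm_orbit n x) = phase E n v (A v) (B j v) x"
      "\<And>y. y \<in> topspace ?X \<Longrightarrow> f y \<noteq> 0"
      by (rule unordered_phase[OF G v ea(1) ea(2)[symmetric] eb(1) eb(2)[symmetric]]) blast
    have f\<Phi>: "f (\<Phi> \<theta> j) = phase E n v (A v) (B j v) (conf j (sh \<theta> j))"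
      "f (\<Phi> \<theta> j') = phase E n v (A v) (B j v) (conf j' (sh \<theta> j'))" for \<theta>
      using f(2)[OF conf_in[OF j]] f(2)[OF conf_in[OF j'(1)]] j j' by (simp_all add: \<Phi>_def)
    have "\<exists>H. continuous_on UNIV H \<and> (\<forall>t z. z \<in> \<int> \<longrightarrow> H (t + z) = H t + 2 * z) \<and>
      (\<forall>\<theta>. phase E n v (A v) (B j v) (conf j \<theta>) = cis (2 * pi * H (\<theta> i)))"
      unfolding conf_def v_def by (rule tripod_torus.phase_lift[OF torus[OF j] i])
    then obtain H where H: "continuous_on UNIV H \<and> (\<forall>t z. z \<in> \<int> \<longrightarrow> H (t + z) = H t + 2 * z) \<and>
      (\<forall>\<theta>. phase E n v (A v) (B j v) (conf j \<theta>) = cis (2 * pi * H (\<theta> i)))" ..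
    note H = H[THEN conjunct1] H[THEN conjunct2, THEN conjunct1] H[THEN conjunct2, THEN conjunct2]
    have "\<exists>g i'. continuous_on UNIV g \<and> (\<forall>t z. z \<in> \<int> \<longrightarrow> g (t + z) = g t) \<and>
      (\<forall>\<theta>. phase E n v (A v) (B j v) (conf j' \<theta>) = cis (2 * pi * g (\<theta> i')))"
    proof (cases "\<exists>i'<r. u j' i' = v")
      case True
      then obtain i' where i': "i' < r" "u j' i' = v"
        by blast
      have "B j v \<notin> {A v, B j' v, C v}"
        using dist j'(2)[OF i'] by auto
      then show ?thesis
        using tripod_torus.phase_lift_unused[OF torus[OF j'(1)] i'(1), of "B j v",
            unfolded i'(2), folded conf_eq, OF e(2)] by blast
    next
      case False
      have "phase E n v (A v) (B j v) (conf j' \<theta>) = 1" for \<theta>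
      \<comment> \<open>For n = 2 the vertex \<open>v\<close> may lie at an arm end of the other
        star; for larger n subdivision rules this out, and no particle ever has weight at
        \<open>v\<close>.\<close>
      proof (cases "n = 2")
        case True
        show ?thesis
          unfolding conf_def
          by (rule tripod_torus.phase_two_particles[OF torus[OF j'(1)] True e(1,2) dist(1)]) (use False r in auto)
      next
        case n2: False
        show ?thesis
          unfolding conf_def
        proof (rule tripod_torus.phase_far[OF torus[OF j'(1)] v e(1,2)])
          fix p assume "p < n"
          show "v \<notin> tripod_torus.base r (u j') (\<lambda>i. A (u j' i)) (\<lambda>i. B j' (u j' i)) (\<lambda>i. C (u j' i)) x0 p"
          proof (cases "p div 2 < r")
            case True
            have "v \<notin> ?st j' (p div 2)"
            proof
              assume "v \<in> ?st j' (p div 2)"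
              from star_edge[OF j'(1) True this] have "{u j' (p div 2), v} \<in> E"
                using False True by auto
              then have "n \<le> 2"
                using adjacent deg2[OF j'(1) True] deg2[OF j i] by (simp add: v_def)
              then show False
                using n2 n r by auto
            qed
            then show ?thesis
              using True by (simp add: tripod_torus.base_def[OF torus[OF j'(1)]])
          next
            case False
            then show ?thesis
              using deg[OF j i] x0 by (auto simp: tripod_torus.base_def[OF torus[OF j'(1)]] v_def)
          qed
        qed
      qed
      then show ?thesis
        by (intro exI[of _ "\<lambda>_. 0"] exI[of _ 0]) simp
    qed
    then obtain g where "\<exists>i'. continuous_on UNIV g \<and> (\<forall>t z. z \<in> \<int> \<longrightarrow> g (t + z) = g t) \<and>
      (\<forall>\<theta>. phase E n v (A v) (B j v) (conf j' \<theta>) = cis (2 * pi * g (\<theta> i')))" ..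
    then obtain i' where g: "continuous_on UNIV g \<and> (\<forall>t z. z \<in> \<int> \<longrightarrow> g (t + z) = g t) \<and>
      (\<forall>\<theta>. phase E n v (A v) (B j v) (conf j' \<theta>) = cis (2 * pi * g (\<theta> i')))" ..
    note g = g[THEN conjunct1] g[THEN conjunct2, THEN conjunct1] g[THEN conjunct2, THEN conjunct2]
    \<comment> \<open>\<open>g\<close> is periodic, so subtracting it leaves the winding of
      \<open>H\<close> along its single circle unchanged.\<close>
    define h where "h = (\<lambda>\<theta>. H (sh \<theta> j i) - g (sh \<theta> j' i'))"
    have "continuous_on UNIV h"
      unfolding h_def sh_def
      by (intro continuous_intros continuous_on_compose2[OF H(1)] continuous_on_compose2[OF g(1)]) auto
    moreover have "f (\<Phi> \<theta> j) = cis (2 * pi * h \<theta>) * f (\<Phi> \<theta> j')" for \<theta>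
    proof -
      have "f (\<Phi> \<theta> j) = cis (2 * pi * H (sh \<theta> j i))" "f (\<Phi> \<theta> j') = cis (2 * pi * g (sh \<theta> j' i'))"
        using H(3) g(3) by (simp_all add: f\<Phi>)
      then show ?thesis
        by (simp add: cis_mult h_def algebra_simps)
    qed
    moreover have "h (\<lambda>j. \<theta> j + z j) = h \<theta> + 2 * z x" if "\<forall>j. z j \<in> \<int>" for \<theta> z
      using that H(2) g(2) by (simp add: h_def sh_def xji)
    ultimately have "Q x f j j' h"
      unfolding Q_def using f(1,3) j j'(1) by blast
    then show ?thesis by blast
  qed
  then have "\<forall>x\<in>{..<s * r}. \<exists>t. Q x (fst t) (fst (snd t)) (fst (snd (snd t))) (snd (snd (snd t)))"
    by simp
  then obtain t where "\<forall>x\<in>{..<s * r}. Q x (fst (t x)) (fst (snd (t x))) (fst (snd (snd (t x)))) (snd (snd (snd (t x))))"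
    by (rule bchoice[THEN exE])
  note t = bspec[OF this]
  define f where "f = (\<lambda>x. fst (t x))"
  define p where "p = (\<lambda>x. fst (snd (t x)))"
  define q where "q = (\<lambda>x. fst (snd (snd (t x))))"
  define h where "h = (\<lambda>x. snd (snd (snd (t x))))"
  have "Q x (f x) (p x) (q x) (h x)" if "x < s * r" for x
    using t[of x] that by (simp add: f_def p_def q_def h_def)
  note * = this[unfolded Q_def]
  show ?thesis
  proof (rule TC_ge_of_torus_map[where s = s and X = ?X and N = "s * r" and \<Phi> = \<Phi> and a = f and p = p and q = q
        and h = h and d = 2])
    fix \<theta> z :: "nat \<Rightarrow> real" assume z: "\<And>j. z j \<in> \<int>"
    show "\<Phi> (\<lambda>j. \<theta> j + z j) = \<Phi> \<theta>"
      by (rule \<Phi>per) (rule z)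
    fix x assume x: "x < s * r"
    show "h x (\<lambda>j. \<theta> j + z j) = h x \<theta> + 2 * z x"
      using *[OF x] z by simp
  next
    fix x assume x: "x < s * r"
    show "continuous_map ?X euclidean (f x)" "p x < s" "q x < s" "continuous_on UNIV (h x)"
      using *[OF x] by simp_all
    show "f x (\<Phi> \<theta> (p x)) = cis (2 * pi * h x \<theta>) * f x (\<Phi> \<theta> (q x))" for \<theta>
      using *[OF x] by simp
    show "f x y \<noteq> 0" if "y \<in> topspace ?X" for y
      using *[OF x] that by simp
  qed (use s \<Phi> in simp_all)
qed

section \<open>Distribution of the vertices over the tori\<close>

text \<open>Each of the q blocks of s consecutive numbers loses exactly one member, the one in the
  class of \<open>j\<close>.\<close>

lemma card_mod_ne:
  assumes "j < s"
  shows "card {i. i < s * q \<and> i mod s \<noteq> j} = q * (s - 1)"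
proof -
  have "{i. i < s * q \<and> i mod s = j} = (\<lambda>t. t * s + j) ` {..<q}"
  proof (intro equalityI subsetI)
    fix i assume "i \<in> {i. i < s * q \<and> i mod s = j}"
    then have "i = (i div s) * s + j" "i div s < q"
      using div_mult_mod_eq[of i s] by (auto simp: less_mult_imp_div_less mult.commute)
    then show "i \<in> (\<lambda>t. t * s + j) ` {..<q}"
      by blast
  next
    fix i assume "i \<in> (\<lambda>t. t * s + j) ` {..<q}"
    then obtain t where t: "t < q" "i = t * s + j"
      by blast
    then have "i < (t + 1) * s"
      using assms by simp
    also have "\<dots> \<le> q * s"
      using t by (intro mult_right_mono) auto
    finally show "i \<in> {i. i < s * q \<and> i mod s = j}"
      using t assms by (simp add: mult.commute)
  qed
  then have "card {i. i < s * q \<and> i mod s = j} = card ((\<lambda>t. t * s + j) ` {..<q})"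
    by simp
  also have "\<dots> = q"
    using assms by (subst card_image) (auto simp: inj_on_def)
  finally have "card {i. i < s * q \<and> i mod s = j} = q" .
  moreover have "{i. i < s * q \<and> i mod s \<noteq> j} = {..<s * q} - {i. i < s * q \<and> i mod s = j}"
    by auto
  ultimately have "card {i. i < s * q \<and> i mod s \<noteq> j} = s * q - q"
    by (simp add: card_Diff_subset subset_eq)
  then show ?thesis
    by (simp add: diff_mult_distrib2 mult.commute)
qed

text \<open>
  Cut off at \<open>s * (card K div s)\<close>, the elements of \<open>K\<close> fall into groups of \<open>s\<close>; the set
  \<open>S j\<close> leaves out the \<open>j\<close>-th member of every group, and all of the remainder.
\<close>

lemma ex_sets_avoiding:
  assumes fin: "finite K" "finite D" and disj: "D \<inter> K = {}" and s: "0 < s"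
    and r: "r \<le> card D + card K div s * (s - 1)"
  shows "\<exists>S. \<forall>j<s. S j \<subseteq> D \<union> K \<and> card (S j) = r \<and> (\<forall>v\<in>K. \<exists>j'<s. v \<notin> S j')"
proof -
  define q where "q = card K div s"
  have sq: "s * q \<le> card K"
    by (simp add: q_def)
  obtain f where f: "bij_betw f {0..<card K} K"
    using ex_bij_betw_nat_finite[OF fin(1)] by blast
  define L where "L = (\<lambda>j. f ` {i. i < s * q \<and> i mod s \<noteq> j})"
  have inj: "inj_on f {0..<card K}" and img: "f ` {0..<card K} = K"
    using f by (auto simp: bij_betw_def)
  have LK: "L j \<subseteq> K" for j
  proof -
    have "L j \<subseteq> f ` {0..<card K}"
      unfolding L_def using sq by (intro image_mono) auto
    then show ?thesis
      by (simp only: img)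
  qed
  have cardL: "card (L j) = q * (s - 1)" if "j < s" for j
  proof -
    have "inj_on f {i. i < s * q \<and> i mod s \<noteq> j}"
      by (rule inj_on_subset[OF inj]) (use sq in auto)
    then show ?thesis
      using card_mod_ne[OF that] by (simp add: L_def card_image)
  qed
  have "\<exists>S. S \<subseteq> D \<union> L j \<and> card S = r" if "j < s" for j
  proof -
    have "card (D \<union> L j) = card D + card (L j)"
      using fin LK[of j] disj finite_subset[OF LK fin(1)] by (intro card_Un_disjoint) auto
    then have "r \<le> card (D \<union> L j)"
      using r cardL[OF that] by (simp add: q_def)
    then show ?thesis
      by (rule obtain_subset_with_card_n) blast
  qed
  then have "\<forall>j\<in>{..<s}. \<exists>S. S \<subseteq> D \<union> L j \<and> card S = r"
    by simp
  then obtain S where "\<forall>j\<in>{..<s}. S j \<subseteq> D \<union> L j \<and> card (S j) = r"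
    by (rule bchoice[THEN exE])
  then have S: "S j \<subseteq> D \<union> L j" "card (S j) = r" if "j < s" for j
    using that by simp_all
  have "\<exists>j<s. v \<notin> S j" if v: "v \<in> K" for v
  proof -
    have "v \<in> f ` {0..<card K}"
      using v img by simp
    then obtain i where i: "i < card K" "v = f i"
      by auto
    \<comment> \<open>The index \<open>i mod s\<close> also serves the remainder, whose elements lie
      in no \<open>L j\<close>.\<close>
    have "v \<notin> L (i mod s)"
    proof
      assume "v \<in> L (i mod s)"
      then obtain i' where i': "i' < s * q" "i' mod s \<noteq> i mod s" "f i' = f i"
        using i by (auto simp: L_def)
      have "i' = i"
        using inj_onD[OF inj i'(3)] i i' sq by simp
      with i' show False by simp
    qed
    moreover have "v \<notin> D"
      using disj v by blast
    moreover have "i mod s < s"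
      using s by simp
    ultimately show ?thesis
      using S(1)[of "i mod s"] by blast
  qed
  moreover have "S j \<subseteq> D \<union> K" if "j < s" for j
    using S(1)[OF that] LK[of j] by blast
  ultimately show ?thesis
    using S(2) by (intro exI[of _ S]) simp
qed

theorem theorem4p3:
  fixes s n m k \<epsilon> :: nat and l :: int
    and V :: "'a set" and E :: "'a set set"
  assumes "2 \<le> s"
    and "fin_tree V E"
    and "m = card (essential_vertices V E)"
    and "k = card {v \<in> V. vertex_degree E v = 3}"
    and "\<epsilon> \<in> {0, 1}"
    and "l \<le> \<lfloor>real k / real s\<rfloor> * (int s - 1)"
    and "0 < n"
    and "int n = 2 * (int m - int k + l) + int \<epsilon>"
    and "sufficiently_subdivided V E n"
  shows "enat (nat (int s * (int m - int k + l))) \<le> TC s (unordered_discrete_conf V E n)"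
proof (cases "int m - int k + l \<le> 0")
  \<comment> \<open>The truncation \<open>nat\<close> turns a bound that is not positive into
    0.\<close>
  case True
  then have "nat (int s * (int m - int k + l)) = 0"
    by (simp add: mult_nonneg_nonpos)
  then show ?thesis
    by (simp add: zero_enat_def[symmetric])
next
  case False
  define r where "r = nat (int m - int k + l)"
  have r: "0 < r" "int m - int k + l = int r"
    using False by (simp_all add: r_def)
  have n: "n = 2 * r \<or> n = 2 * r + 1"
    using assms(5,8) r(2) by auto
  have G: "fin_graph V E"
    using assms(2) by (simp add: fin_tree_def)
  have fin: "finite V"
    using G by (simp add: fin_graph_def)
  define D where "D = {v \<in> V. 4 \<le> vertex_degree E v}"
  define K where "K = {v \<in> V. vertex_degree E v = 3}"
  have DK: "finite D" "finite K" "D \<inter> K = {}" "essential_vertices V E = D \<union> K"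
    using fin by (auto simp: D_def K_def essential_vertices_def)
  have m: "m = card D + card K"
    using DK by (simp add: assms(3) card_Un_disjoint)
  have k: "k = card K"
    by (simp add: assms(4) K_def)
  have "\<lfloor>real k / real s\<rfloor> = int (k div s)"
    by (rule floor_divide_of_nat_eq)
  \<comment> \<open>As m - k counts the vertices of degree at least four, the bound on l says that r
    vertices fit into \<open>D\<close> and the groups of \<open>K\<close> with one member of each
    left out.\<close>
  then have "int r \<le> int (card D) + int (k div s) * (int s - 1)"
    using assms(6) r(2) m k by simp
  also have "\<dots> = int (card D + card K div s * (s - 1))"
    using assms(1) k by (simp add: of_nat_diff)
  finally have "r \<le> card D + card K div s * (s - 1)"
    by (simp only: of_nat_le_iff)
  then have "\<exists>S. \<forall>j<s. S j \<subseteq> D \<union> K \<and> card (S j) = r \<and> (\<forall>v\<in>K. \<exists>j'<s. v \<notin> S j')"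
    using DK assms(1) by (intro ex_sets_avoiding) simp_all
  then obtain S where *: "\<forall>j<s. S j \<subseteq> D \<union> K \<and> card (S j) = r \<and> (\<forall>v\<in>K. \<exists>j'<s. v \<notin> S j')" ..
  have S: "S j \<subseteq> D \<union> K" "card (S j) = r" "\<forall>v\<in>K. \<exists>j'<s. v \<notin> S j'" if "j < s" for j
    using * that by simp_all
  have "\<exists>f. bij_betw f {0..<r} (S j)" if "j < s" for j
    using ex_bij_betw_nat_finite[of "S j"] S(1,2)[OF that] DK finite_subset[of "S j" "D \<union> K"] by simp
  then obtain u where u: "\<And>j. j < s \<Longrightarrow> bij_betw (u j) {0..<r} (S j)"
    by metis
  \<comment> \<open>Two different tripods are demanded at the vertices of \<open>D\<close>; at
    degree three they coincide, and the choice of the sets \<open>S\<close> does the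
    separating.\<close>
  define Q where "Q = (\<lambda>v a b b' c. tripod V E v a b c \<and> tripod V E v a b' c \<and> (v \<in> D \<longrightarrow> b \<noteq> b'))"
  have "\<exists>a b b' c. Q v a b b' c" if v: "v \<in> D \<union> K" for v
  proof (cases "v \<in> D")
    case True
    then have "4 \<le> vertex_degree E v"
      by (simp add: D_def)
    then obtain a b b' c where "{v, a} \<in> E" "{v, b} \<in> E" "{v, b'} \<in> E" "{v, c} \<in> E"
      "a \<noteq> b" "a \<noteq> b'" "a \<noteq> c" "b \<noteq> c" "b' \<noteq> c" "b \<noteq> b'"
      by (rule obtain_four_neighbours[OF G])
    then have "Q v a b b' c"
      using assms(2) by (simp add: Q_def tripod_def)
    then show ?thesis by blast
  next
    case False
    with v have "3 \<le> vertex_degree E v"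
      by (simp add: K_def)
    then obtain a b c where "{v, a} \<in> E" "{v, b} \<in> E" "{v, c} \<in> E" "a \<noteq> b" "a \<noteq> c" "b \<noteq> c"
      by (rule obtain_three_neighbours[OF G])
    then have "Q v a b b c"
      using assms(2) False by (simp add: Q_def tripod_def)
    then show ?thesis by blast
  qed
  then have "\<forall>v\<in>D \<union> K. \<exists>t. Q v (fst t) (fst (snd t)) (fst (snd (snd t))) (snd (snd (snd t)))"
    by simp
  then obtain t where
    "\<forall>v\<in>D \<union> K. Q v (fst (t v)) (fst (snd (t v))) (fst (snd (snd (t v)))) (snd (snd (snd (t v))))"
    by (rule bchoice[THEN exE])
  note t = bspec[OF this]
  define A where "A = (\<lambda>v. fst (t v))"
  define B where "B = (\<lambda>j::nat. \<lambda>v. if j = 0 then fst (snd (t v)) else fst (snd (snd (t v))))"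
  define C where "C = (\<lambda>v. snd (snd (snd (t v))))"
  have Q: "tripod V E v (A v) (B j v) (C v)" "v \<in> D \<Longrightarrow> B 0 v \<noteq> B 1 v" if "v \<in> D \<union> K" for v j
    using t[OF that] by (simp_all add: Q_def A_def B_def C_def)
  have uS: "u j i \<in> S j" if "j < s" "i < r" for j i
    using bij_betwE[OF u[OF that(1)]] that(2) by simp
  have uDK: "u j i \<in> D \<union> K" if "j < s" "i < r" for j i
    using uS[OF that] S(1)[OF that(1)] by blast
  have "enat (s * r) \<le> TC s (unordered_discrete_conf V E n)"
  proof (rule TC_ge_of_tripods[where u = u and A = A and B = B and C = C])
    fix j i assume ji: "j < s" "i < r"
    show "3 \<le> vertex_degree E (u j i)"
      using uDK[OF ji] by (auto simp: D_def K_def)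
    show "tripod V E (u j i) (A (u j i)) (B j (u j i)) (C (u j i))"
      by (rule Q(1)[OF uDK[OF ji]])
    show "\<exists>j'<s. \<forall>i'<r. u j' i' = u j i \<longrightarrow> B j' (u j i) \<noteq> B j (u j i)"
    proof (cases "u j i \<in> D")
      case True
      \<comment> \<open>\<open>B\<close> has one value in torus 0 and another in all later ones, so
        torus 0 separates from each later torus, and torus 1 separates from torus 0.\<close>
      define j' where "j' = (if j = 0 then 1 else 0 :: nat)"
      have "B j' (u j i) \<noteq> B j (u j i)"
        using Q(2)[OF uDK[OF ji] True] by (cases "j = 0") (simp_all add: B_def j'_def)
      moreover have "j' < s"
        using assms(1) by (simp add: j'_def)
      ultimately show ?thesis by blast
    next
      case False
      then have "u j i \<in> K"
        using uDK[OF ji] by blast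
      then obtain j' where "j' < s" "u j i \<notin> S j'"
        using S(3)[OF ji(1)] by auto
      moreover have "u j' i' \<noteq> u j i" if "i' < r" for i'
        using uS[OF \<open>j' < s\<close> that] \<open>u j i \<notin> S j'\<close> by auto
      ultimately show ?thesis
        by (intro exI[of _ j']) simp
    qed
  next
    fix j assume "j < s"
    then show "inj_on (u j) {..<r}"
      using u by (auto simp: bij_betw_def atLeast0LessThan)
  qed (use assms r n in simp_all)
  moreover have "nat (int s * (int m - int k + l)) = s * r"
    by (simp add: r(2) nat_mult_distrib)
  ultimately show ?thesis
    by simp
qed

end
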